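(* Let $p=(12,R)$ be a mesh pattern where $R$ is any one of the following eight sets of shaded cells: $\{(0,2),(2,2),(1,1),(2,1),(0,0)\}$, $\{(0,2),(2,2),(1,1),(0,0),(1,0)\}$, $\{(1,2),(2,2),(1,1),(0,0),(2,0)\}$, $\{(2,2),(0,1),(1,1),(0,0),(2,0)\}$, $\{(0,2),(2,2),(0,1),(1,1),(2,0)\}$, $\{(0,2),(1,2),(1,1),(0,0),(2,0)\}$, $\{(0,2),(1,1),(2,1),(0,0),(2,0)\}$, $\{(0,2),(2,2),(1,1),(1,0),(2,0)\}$. Then $A(t)=F(t)-F_{\ge 1}(t,1)$ and $$F_{\ge 1}(t,q)=\sum_{n\ge 0}t^n q\Bigg[\sum_{\substack{i,j,k,m\ge 0\\ i+j+k+m=n-2}}\binom{j+k}{k}(i+j)!\,T_m S_k+\sum_{\substack{i,j_1,j_2,k_1,k_2,m\ge 0\\ i+j_1+j_2+k_1+k_2+m=n-4}}\binom{k_2+j_2+1}{k_2}\binom{k_1+j_1}{k_1}k_1!\,(i+j_1+j_2+1)!\,T_m S_{k_2}\Bigg],$$ where $$T_m:=T_m(q)=[t^m]\frac{F(t)}{1+t(1-q)F(t)},\qquad S_k:=[t^k]\frac{F(t)}{1+tF(t)}.$$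
   Context: $\mathfrak S_n$ is the set of permutations of $\{1,\dots,n\}$ in one-line notation $\sigma=\sigma_1\cdots\sigma_n$. For $R\subseteq\{0,1,2\}^2$, an occurrence of the mesh pattern $(12,R)$ in $\sigma\in\mathfrak S_n$ is a pair of positions $i_1<i_2$ with $\sigma_{i_1}<\sigma_{i_2}$ such that, setting $i_0=0$, $i_3=n+1$, $v_0=0$, $v_1=\sigma_{i_1}$, $v_2=\sigma_{i_2}$, $v_3=n+1$, for every $(x,y)\in R$ there is no index $\ell$ with $i_x<\ell<i_{x+1}$ and $v_y<\sigma_\ell<v_{y+1}$. Let $s_{n,k}(p)$ be the number of $\sigma\in\mathfrak S_n$ with exactly $k$ occurrences of $p$. All generating functions are formal power series: $F(t,q)=\sum_{n,k\ge 0}s_{n,k}(p)q^kt^n$, $A(t)=F(t,0)$, $F(t)=F(t,1)=\sum_{n\ge 0}n!\,t^n$, and $F_{\ge 1}(t,q)=F(t,q)-A(t)=\sum_{n\ge 0,\,k\ge 1}s_{n,k}(p)q^kt^n$. $[t^m]G$ denotes the coefficient of $t^m$ in $G$. Empty sums are $0$. *)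

theory Defs
  imports
    "HOL-Computational_Algebra.Computational_Algebra"
    "HOL-Combinatorics.Permutations"
begin

text \<open>
  A permutation of \<open>{1..n}\<close> is a function \<open>\<sigma>\<close> with \<open>\<sigma> permutes {1..n}\<close>; its one-line notation is
  \<open>\<sigma> 1, \<dots>, \<sigma> n\<close>. A mesh pattern \<open>(12, R)\<close> is given by its set \<open>R\<close> of shaded cells, a subset of
  \<open>{0,1,2} \<times> {0,1,2}\<close>.
\<close>

definition is_occurrence :: "(nat \<times> nat) set \<Rightarrow> nat \<Rightarrow> (nat \<Rightarrow> nat) \<Rightarrow> nat \<times> nat \<Rightarrow> bool" where
  "is_occurrence R n \<sigma> = (\<lambda>(i1, i2).
     i1 \<in> {1..n} \<and> i2 \<in> {1..n} \<and> i1 < i2 \<and> \<sigma> i1 < \<sigma> i2 \<and>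
     (let i = (!) [0, i1, i2, n + 1]; v = (!) [0, \<sigma> i1, \<sigma> i2, n + 1]
      in \<forall>(x, y) \<in> R. \<not> (\<exists>l \<in> {1..n}. i x < l \<and> l < i (x + 1) \<and> v y < \<sigma> l \<and> \<sigma> l < v (y + 1))))"

definition occurrences :: "(nat \<times> nat) set \<Rightarrow> nat \<Rightarrow> (nat \<Rightarrow> nat) \<Rightarrow> nat" where
  "occurrences R n \<sigma> = card {p. is_occurrence R n \<sigma> p}"

definition s_count :: "(nat \<times> nat) set \<Rightarrow> nat \<Rightarrow> nat \<Rightarrow> nat" where
  "s_count R n k = card {\<sigma>. \<sigma> permutes {1..n} \<and> occurrences R n \<sigma> = k}"

text \<open>
  For each \<open>n\<close> only finitely many \<open>s_count R n k\<close> are nonzero, so the bivariate generating function is a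
  formal power series in \<open>t\<close> (the variable \<open>fps_X\<close>) whose coefficients are polynomials in \<open>q\<close>
  (the variable \<open>[:0, 1:]\<close>).
\<close>

definition F_biv :: "(nat \<times> nat) set \<Rightarrow> int poly fps" where
  "F_biv R = Abs_fps (\<lambda>n. Abs_poly (\<lambda>k. int (s_count R n k)))"

definition subst_q :: "int poly fps \<Rightarrow> int \<Rightarrow> int fps" where
  "subst_q G c = Abs_fps (\<lambda>n. poly (G $ n) c)"

definition A_ser :: "(nat \<times> nat) set \<Rightarrow> int fps" where
  "A_ser R = subst_q (F_biv R) 0"

text \<open>The embedding of series in \<open>t\<close> alone, needed to subtract \<open>A(t)\<close> from \<open>F(t,q)\<close>.\<close>

definition lift_q :: "int fps \<Rightarrow> int poly fps" where
  "lift_q G = Abs_fps (\<lambda>n. [:G $ n:])"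

definition F_ge1 :: "(nat \<times> nat) set \<Rightarrow> int poly fps" where
  "F_ge1 R = F_biv R - lift_q (A_ser R)"

text \<open>\<open>F(t)\<close> is polymorphic because it is used over \<open>\<int>\<close> and over \<open>\<int>[q]\<close>.\<close>

definition F_ser :: "'a::comm_ring_1 fps" where
  "F_ser = Abs_fps (\<lambda>n. of_nat (fact n))"

text \<open>
  The type \<^typ>\<open>int poly\<close> is not in class \<^class>\<open>inverse\<close>, so \<open>/\<close> is not available for series over
  it. The quotient by a series with constant coefficient 1 is formed with the inverse over
  arbitrary rings.
\<close>

definition quot_ser :: "'a::comm_ring_1 fps \<Rightarrow> 'a fps \<Rightarrow> 'a fps" where
  "quot_ser f g = f * fps_right_inverse g 1"

definition T_coeff :: "nat \<Rightarrow> int poly" where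
  "T_coeff m = quot_ser F_ser (1 + fps_X * fps_const (1 - [:0, 1:]) * F_ser) $ m"

definition S_coeff :: "nat \<Rightarrow> int" where
  "S_coeff k = quot_ser F_ser (1 + fps_X * F_ser) $ k"

lemma quot_ser_mult:
  assumes "g $ 0 = 1"
  shows "quot_ser f g * g = f"
proof -
  have "g * fps_right_inverse g 1 = 1"
    using fps_right_inverse[of g 1] assms by simp
  then show ?thesis by (metis mult.assoc mult.commute mult.right_neutral quot_ser_def)
qed

lemma occurrences_le: "occurrences R n \<sigma> \<le> n * n"
proof -
  have "occurrences R n \<sigma> \<le> card ({1..n} \<times> {1..n})"
    unfolding occurrences_def by (rule card_mono) (auto simp: is_occurrence_def)
  then show ?thesis by simp
qed

lemma coeff_F_biv: "coeff (F_biv R $ n) k = int (s_count R n k)"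
proof -
  have "s_count R n k = 0" if "k > n * n" for k
  proof -
    have "{\<sigma>. \<sigma> permutes {1..n} \<and> occurrences R n \<sigma> = k} = {}"
      using occurrences_le[of R n] that leD by blast
    then show ?thesis unfolding s_count_def by (metis card.empty)
  qed
  then have "\<forall>\<^sub>\<infinity>k. int (s_count R n k) = 0"
    by (auto simp: MOST_nat)
  then show ?thesis by (simp add: F_biv_def coeff_Abs_poly Abs_poly_inverse)
qed

lemma coeff_F_ge1: "coeff (F_ge1 R $ n) k = (if k \<ge> 1 then int (s_count R n k) else 0)"
  by (cases k) (simp_all add: F_ge1_def lift_q_def A_ser_def subst_q_def coeff_F_biv poly_0_coeff_0)

lemma subst_q_F_biv_1: "subst_q (F_biv R) 1 = F_ser"
proof (rule fps_ext)
  fix n :: nat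
  let ?P = "{\<sigma>. \<sigma> permutes {1..n}}"
  have fin: "finite ?P" by (rule finite_permutations) simp
  have "F_biv R $ n = (\<Sum>\<sigma>\<in>?P. monom 1 (occurrences R n \<sigma>))"
  proof (rule poly_eqI)
    fix k
    have "(\<Sum>\<sigma>\<in>?P. if occurrences R n \<sigma> = k then 1 else 0) =
        int (card {\<sigma> \<in> ?P. occurrences R n \<sigma> = k})"
      using fin by (simp add: sum.If_cases Int_def)
    then show "coeff (F_biv R $ n) k = coeff (\<Sum>\<sigma>\<in>?P. monom 1 (occurrences R n \<sigma>)) k"
      by (simp add: coeff_F_biv s_count_def coeff_sum)
  qed
  then have "poly (F_biv R $ n) 1 = int (card ?P)"
    by (simp add: poly_sum poly_monom)
  also have "card ?P = fact n" by (rule card_permutations) simp_all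
  finally show "subst_q (F_biv R) 1 $ n = F_ser $ n"
    by (simp add: subst_q_def F_ser_def)
qed

end

theory Submission
  imports Defs "HOL-Combinatorics.Multiset_Permutations"
begin

text \<open>
  Inverse and reverse-complement of permutations carry the eight patterns to two of them, the meshes
  \<open>{(0,0), (0,2), (1,1), (2,1), (2,y)}\<close> with \<open>y = 2\<close> or \<open>y = 0\<close>
  (\<open>F_biv_eight_patterns\<close>). For such a mesh the first four cells say that the entries to the left
  of the first point \<open>a\<close> of an occurrence \<open>a < b\<close> are exactly the values strictly between \<open>a\<close>
  and \<open>b\<close>. So an occurrence is a prefix that is a block of consecutive values \<open>a, \<dots>, b - 1\<close> and
  ends with its minimum \<open>a\<close>, followed somewhere by \<open>b\<close>; the fifth cell makes all
  entries after \<open>b\<close> smaller than \<open>b\<close> (\<open>y = 2\<close>) or larger (\<open>y = 0\<close>). From now on the two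
  patterns differ only in this relation \<open>r\<close>.

  All occurrences in one permutation share the second point \<open>b\<close>: if a longer block
  contained \<open>b\<close>, its minimum and its own second point would both come after \<open>b\<close> and lie on
  opposite sides of it. Hence the occurrences form a chain of nested
  blocks. Delete the block of one occurrence. What is left is a list that contains \<open>b\<close>, a
  \<^emph>\<open>remainder\<close>, and the longer occurrences are those prefixes of the remainder that
  fill the values directly below \<open>a\<close> and again end with their minimum (\<open>occ_starts_after\<close>).

  For a finite set \<open>E\<close> of positions,
  \<open>q ^ |E| = 1 + (q - 1) * (\<Sum>k\<in>E. q ^ |{l \<in> E. l > k}|)\<close>. Summing this over permutations,
  and splitting each at the occurrence with position \<open>k\<close> into an arbitrary arrangement of the block and a
  remainder, gives \<open>W = F + (q - 1) t\<^sup>2 F Z\<close>, where \<open>W\<close> is the bivariate series and \<open>Z\<close> is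
  the weighted series of remainders. Splitting remainders in the same way gives
  \<open>Z = N + (q - 1) t F Z\<close>, where \<open>N\<close> counts remainders without weight. The coefficient of \<open>t\<^sup>s\<close> in
  \<open>N\<close> is \<open>\<Sum>h\<le>s. (s + 1)! / (h + 1)\<close> for both relations: with \<open>h\<close> values below the block and \<open>u\<close>
  values above \<open>b\<close>, one relation asks \<open>b\<close> to come last among \<open>u + 1\<close> entries, the other among \<open>h + 1\<close>
  entries.

  Since \<open>T = F / (1 + t (1 - q) F)\<close>, this yields \<open>F Z = T N\<close>. With \<open>C = N / (1 + t F)\<close>, which is
  \<open>Z\<close> at \<open>q = 0\<close>, one gets \<open>W = q t\<^sup>2 T C + (F - t\<^sup>2 F C)\<close>, and the bracket is free of \<open>q\<close>, so
  the part of \<open>W\<close> with at least one occurrence is \<open>q t\<^sup>2 T C\<close> (\<open>F_biv_canonical_eq_terminal\<close>). Finally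
  \<open>1 / (1 + t F) = 1 - t S\<close>, so \<open>C = N - t S N\<close>; expanding \<open>h! = S\<^sub>h + (\<Sum>k<h. S\<^sub>k (h - 1 - k)!)\<close>
  in \<open>N\<close> and evaluating two binomial sums turns \<open>C\<close> into the explicit double expression of the
  theorem (\<open>terminal_ser_nth\<close>).
\<close>

section \<open>Occurrences as nested blocks\<close>

text \<open>
  Put \<open>q = 1 + x\<close>: the left side sums \<open>x ^ |M|\<close> over all \<open>M \<subseteq> E\<close>. A nonempty \<open>M\<close> has a least
  element \<open>k\<close>, and the rest of \<open>M\<close> is an arbitrary subset of the elements above \<open>k\<close>. This is what
  allows one occurrence to be cut off at a time, with only the later ones still weighted.
\<close>
lemma power_card_expand:
  fixes q :: "'a::comm_ring_1" and E :: "nat set"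
  assumes "finite E"
  shows "q ^ card E = 1 + (q - 1) * (\<Sum>k\<in>E. q ^ card (E \<inter> {k<..}))"
  using assms
proof (induction rule: finite_linorder_min_induct)
  case empty
  show ?case by simp
next
  case (insert b A)
  have 1: "insert b A \<inter> {b<..} = A" using insert by auto
  have 2: "insert b A \<inter> {k<..} = A \<inter> {k<..}" if "k \<in> A" for k
    using insert that by force
  have "b \<notin> A" using insert by auto
  then have "(\<Sum>k\<in>insert b A. q ^ card (insert b A \<inter> {k<..})) = q ^ card A + (\<Sum>k\<in>A. q ^ card (A \<inter> {k<..}))"
    using insert.hyps(1) by (simp add: 1 2)
  moreover have "q ^ card (insert b A) = q ^ card A + (q - 1) * q ^ card A"
    using insert.hyps(1) \<open>b \<notin> A\<close> by (simp add: algebra_simps)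
  moreover note insert.IH
  ultimately show ?case by (simp add: algebra_simps)
qed

definition tail_rel :: "(nat \<Rightarrow> nat \<Rightarrow> bool) \<Rightarrow> nat \<Rightarrow> nat list \<Rightarrow> bool" where
  "tail_rel r b ys \<longleftrightarrow> (\<exists>us vs. ys = us @ b # vs \<and> (\<forall>v\<in>set vs. r v b))"

text \<open>
  The number \<open>k\<close> is the position, counted from 0, of the first point of an occurrence. Its value is
  \<open>a = zs ! k\<close>; the \<open>k\<close> entries before it are the values between the two points, so the second point
  has value \<open>a + k + 1\<close>.
\<close>
definition occ_starts :: "(nat \<Rightarrow> nat \<Rightarrow> bool) \<Rightarrow> nat list \<Rightarrow> nat set" where
  "occ_starts r zs = {k. k < length zs \<and> set (take k zs) = {zs ! k<..<zs ! k + k + 1} \<and>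
     tail_rel r (zs ! k + k + 1) (drop (Suc k) zs)}"

text \<open>
  The prefixes of \<open>ys\<close> that extend a block with minimum \<open>a\<close> to a longer block that again ends with
  its minimum. The equation \<open>ys ! j + j + 1 = a\<close> follows from the condition on the set when \<open>j > 0\<close> and
  \<open>ys\<close> is distinct. For \<open>j = 0\<close> the interval is also empty if \<open>ys ! 0 \<ge> a\<close>, and the
  equation admits \<open>ys ! 0 = a - 1\<close> only.
\<close>
definition blocks_below :: "nat \<Rightarrow> nat list \<Rightarrow> nat set" where
  "blocks_below a ys = {j. j < length ys \<and> ys ! j + j + 1 = a \<and> set (take j ys) = {ys ! j<..<a}}"

text \<open>
  Both \<open>(<)\<close> and \<open>(>)\<close> have this property, and it is all that is needed to see that the
  occurrences in a permutation share their second point.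
\<close>
definition one_sided :: "(nat \<Rightarrow> nat \<Rightarrow> bool) \<Rightarrow> bool" where
  "one_sided r \<longleftrightarrow> (\<forall>x y b. x < b \<longrightarrow> b < y \<longrightarrow> \<not> (r x b \<and> r y b))"

lemma tail_rel_drop:
  assumes "tail_rel r b ys" "b \<notin> set (take j ys)"
  shows "tail_rel r b (drop j ys)"
proof -
  obtain us vs where 1: "ys = us @ b # vs" "\<forall>v\<in>set vs. r v b"
    using assms(1) by (auto simp: tail_rel_def)
  have "j \<le> length us"
  proof (rule ccontr)
    assume "\<not> j \<le> length us"
    then have "b \<in> set (take j ys)" using 1 by (cases "j - length us") auto
    then show False using assms(2) by simp
  qed
  then have "drop j ys = drop j us @ b # vs" using 1 by simp
  then show ?thesis using 1 by (auto simp: tail_rel_def)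
qed

lemma tail_rel_appendI:
  "tail_rel r b ys \<Longrightarrow> tail_rel r b (xs @ ys)"
  unfolding tail_rel_def by (metis append_assoc)

lemma tail_rel_in_set: "tail_rel r b ys \<Longrightarrow> b \<in> set ys"
  by (auto simp: tail_rel_def)

lemma tail_rel_later:
  assumes "tail_rel r b ys" "distinct ys" "b \<in> set (take j ys)" "x \<in> set (drop j ys)"
  shows "r x b"
proof -
  obtain us vs where 1: "ys = us @ b # vs" "\<forall>v\<in>set vs. r v b"
    using assms(1) by (auto simp: tail_rel_def)
  have "length us < j"
  proof (rule ccontr)
    assume "\<not> length us < j"
    then have "b \<in> set us" using 1 assms(3) by (auto dest: in_set_takeD)
    then show False using 1 assms(2) by auto
  qed
  then obtain i where "j = length us + Suc i" by (metis less_iff_Suc_add add_Suc_right)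
  then have "drop j ys = drop i vs" using 1 by simp
  then show ?thesis using 1(2) assms(4) by (auto dest: in_set_dropD)
qed

text \<open>
  The occurrences after a given one see only the entries \<open>ys\<close> behind its block and the minimum \<open>a\<close>
  of the block. The point is that the second value \<open>b'\<close> of a later occurrence equals \<open>b\<close>.
  It is at least \<open>b\<close>, because the longer block contains \<open>b - 1\<close>. If it were larger, the longer block
  would contain \<open>b\<close>; then its minimum and \<open>b'\<close> would come after \<open>b\<close> and lie on
  opposite sides of \<open>b\<close>. With \<open>b' = b\<close> the condition on the entries after \<open>b\<close> is inherited.
\<close>
lemma occ_starts_after:
  assumes r: "one_sided r"
    and d: "distinct (xs @ a # ys)" and xs: "set xs = {a<..<b}" and b: "b = a + length xs + 1"
    and v: "tail_rel r b ys"
  shows "occ_starts r (xs @ a # ys) \<inter> {length xs<..} = (\<lambda>j. length xs + 1 + j) ` blocks_below a ys"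
proof -
  let ?zs = "xs @ a # ys"
  have key: "length xs + 1 + j \<in> occ_starts r ?zs \<longleftrightarrow> j \<in> blocks_below a ys" for j
  proof -
    let ?k = "length xs + 1 + j"
    let ?a' = "ys ! j"
    have nth: "?zs ! ?k = ?a'" by (simp add: nth_append)
    have tk: "set (take ?k ?zs) = {a..<b} \<union> set (take j ys)"
    proof -
      have "{a..<b} = insert a {a<..<b}" using b by auto
      then show ?thesis using xs by auto
    qed
    have dr: "drop (Suc ?k) ?zs = drop (Suc j) ys" by simp
    have dis: "set (take j ys) \<inter> {a..<b} = {}"
    proof -
      have "set ys \<inter> insert a (set xs) = {}" using d by auto
      moreover have "insert a (set xs) = {a..<b}" using xs b by auto
      ultimately show ?thesis using set_take_subset[of j ys] by auto
    qed
    show ?thesis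
    proof
      assume "?k \<in> occ_starts r ?zs"
      then have jl: "j < length ys" and s: "{a..<b} \<union> set (take j ys) = {?a'<..<?a' + ?k + 1}"
        and v': "tail_rel r (?a' + ?k + 1) (drop (Suc j) ys)"
        unfolding occ_starts_def using nth tk dr by auto
      let ?b' = "?a' + ?k + 1"
      have "a \<in> {a..<b}" using b by auto
      then have a': "?a' < a" using s by auto
      have "b - 1 \<in> {a..<b}" using b by auto
      then have "b - 1 < ?b'" using s by auto
      then have "b \<le> ?b'" using b by auto
      moreover have False if "b < ?b'"
      proof -
        have "b \<in> {?a'<..<?b'}" using that a' b by auto
        then have bt: "b \<in> set (take j ys)" using s by auto
        \<comment> \<open>Both the minimum \<open>?a'\<close> of the longer block and its second point \<open>?b'\<close> come after \<open>b\<close>.\<close>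
        have "?a' \<in> set (drop j ys)" using jl by (metis Cons_nth_drop_Suc list.set_intros(1))
        moreover have "?b' \<in> set (drop j ys)"
          using tail_rel_in_set[OF v'] jl by (metis Cons_nth_drop_Suc list.set_intros(2))
        ultimately have "r ?a' b" "r ?b' b" using tail_rel_later[OF v _ bt] d by auto
        then show False using r that a' b unfolding one_sided_def by (metis trans_less_add1 add.assoc)
      qed
      ultimately have bb: "b = ?b'" by (meson le_neq_implies_less)
      then have "a = ?a' + j + 1" using b by simp
      moreover have "set (take j ys) = {?a'<..<a}"
      proof -
        have "set (take j ys) = {?a'<..<b} - {a..<b}" using s bb dis by auto
        also have "\<dots> = {?a'<..<a}" using a' b by auto
        finally show ?thesis .
      qed
      ultimately show "j \<in> blocks_below a ys" using jl by (simp add: blocks_below_def)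
    next
      assume "j \<in> blocks_below a ys"
      then have jl: "j < length ys" and a: "a = ?a' + j + 1" and s: "set (take j ys) = {?a'<..<a}"
        by (auto simp: blocks_below_def)
      have bb: "?a' + ?k + 1 = b" using a b by simp
      have "{a..<b} \<union> set (take j ys) = {?a'<..<b}" using s a b by auto
      moreover have "tail_rel r b (drop (Suc j) ys)"
      proof (rule tail_rel_drop[OF v])
        show "b \<notin> set (take (Suc j) ys)"
          using jl s a b by (auto simp: take_Suc_conv_app_nth)
      qed
      ultimately show "?k \<in> occ_starts r ?zs"
        unfolding occ_starts_def mem_Collect_eq nth tk dr bb using jl by simp
    qed
  qed
  have 2: "k \<in> occ_starts r ?zs \<inter> {length xs<..} \<Longrightarrow> k \<in> (\<lambda>j. length xs + 1 + j) ` blocks_below a ys" for k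
    using key[of "k - length xs - 1"] by (auto intro!: image_eqI[of _ _ "k - length xs - 1"])
  show ?thesis using 2 key by auto
qed

text \<open>
  The same splitting one level down: after a first extension of the block has been removed, further
  extensions are blocks below its minimum \<open>a'\<close>.
\<close>
lemma blocks_below_after:
  assumes d: "distinct (xs @ a' # ys)" and xs: "set xs = {a'<..<a}" and a: "a = a' + length xs + 1"
  shows "blocks_below a (xs @ a' # ys) \<inter> {length xs<..} = (\<lambda>j. length xs + 1 + j) ` blocks_below a' ys"
proof -
  let ?zs = "xs @ a' # ys"
  have key: "length xs + 1 + j \<in> blocks_below a ?zs \<longleftrightarrow> j \<in> blocks_below a' ys" for j
  proof -
    let ?k = "length xs + 1 + j"
    let ?c = "ys ! j"
    have nth: "?zs ! ?k = ?c" by (simp add: nth_append)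
    have ins: "insert a' (set xs) = {a'..<a}" using xs a by auto
    have tk: "set (take ?k ?zs) = {a'..<a} \<union> set (take j ys)"
      using ins by auto
    have dis: "set (take j ys) \<inter> {a'..<a} = {}"
    proof -
      have "set ys \<inter> insert a' (set xs) = {}" using d by auto
      then show ?thesis using set_take_subset[of j ys] ins by auto
    qed
    have e: "(?c + ?k + 1 = a) = (?c + j + 1 = a')" using a by auto
    have f: "({a'..<a} \<union> set (take j ys) = {?c<..<a}) = (set (take j ys) = {?c<..<a'})" if "?c < a'"
    proof -
      have "{?c<..<a} = {a'..<a} \<union> {?c<..<a'}" using that a by auto
      moreover have "{?c<..<a'} \<inter> {a'..<a} = {}" by auto
      ultimately show ?thesis using dis by blast
    qed
    have len: "?k < length ?zs \<longleftrightarrow> j < length ys" by simp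
    show ?thesis unfolding blocks_below_def mem_Collect_eq nth tk e len
      by (intro conj_cong refl f) linarith
  qed
  have 2: "k \<in> blocks_below a ?zs \<inter> {length xs<..} \<Longrightarrow> k \<in> (\<lambda>j. length xs + 1 + j) ` blocks_below a' ys" for k
    using key[of "k - length xs - 1"] by (auto intro!: image_eqI[of _ _ "k - length xs - 1"])
  show ?thesis using 2 key by auto
qed

lemma finite_occ_starts [simp]: "finite (occ_starts r zs)"
  unfolding occ_starts_def by auto

lemma finite_blocks_below [simp]: "finite (blocks_below a ys)"
  unfolding blocks_below_def by auto

section \<open>Splitting at an occurrence\<close>

text \<open>
  What is left of a permutation when the block of an occurrence is removed: \<open>h\<close> values below the
  block, the second point \<open>b\<close> and \<open>u\<close> values above it. The values are not renumbered; the
  gap between \<open>h\<close> and \<open>b\<close> is arbitrary, so removing a further block changes \<open>h\<close> only.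
\<close>
definition remainders :: "(nat \<Rightarrow> nat \<Rightarrow> bool) \<Rightarrow> nat \<Rightarrow> nat \<Rightarrow> nat \<Rightarrow> nat list set" where
  "remainders r b h u = {ys \<in> permutations_of_set ({1..h} \<union> {b..b + u}). tail_rel r b ys}"

lemma finite_remainders [simp]: "finite (remainders r b h u)"
  by (simp add: remainders_def)

text \<open>
  Exactly the values \<open>1, \<dots>, h\<close> lie below the removed block, so its minimum is \<open>h + 1\<close>.
\<close>
definition remainder_poly :: "(nat \<Rightarrow> nat \<Rightarrow> bool) \<Rightarrow> nat \<Rightarrow> nat \<Rightarrow> nat \<Rightarrow> 'a::comm_ring_1 \<Rightarrow> 'a" where
  "remainder_poly r b h u q = (\<Sum>ys\<in>remainders r b h u. q ^ card (blocks_below (h + 1) ys))"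

text \<open>
  A remainder with a marked extension at position \<open>k\<close> consists of an arrangement of the \<open>k\<close> values
  \<open>h - k + 1, \<dots>, h\<close>, the new minimum \<open>h - k\<close>, and a remainder with \<open>h - 1 - k\<close> values
  below. Its later extensions are those of the smaller remainder, so the weights agree.
\<close>
lemma remainder_poly_rec:
  fixes q :: "'a::comm_ring_1"
  assumes hb: "h < b"
  shows "remainder_poly r b h u q = of_nat (card (remainders r b h u)) +
    (q - 1) * (\<Sum>k<h. of_nat (fact k) * remainder_poly r b (h - 1 - k) u q)"
proof -
  let ?C = "remainders r b h u"
  let ?D = "blocks_below (h + 1)"
  have sub: "?D ys \<subseteq> {..<h}" if "ys \<in> ?C" for ys
  proof
    fix j assume j: "j \<in> ?D ys"
    then have "ys ! j \<in> {1..h} \<union> {b..b+u}" "ys ! j + j = h"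
      using that nth_mem[of j ys] by (auto simp: blocks_below_def remainders_def permutations_of_set_def)
    then show "j \<in> {..<h}" using hb by auto
  qed
  have inner: "(\<Sum>ys | ys \<in> ?C \<and> k \<in> ?D ys. q ^ card (?D ys \<inter> {k<..})) =
      of_nat (fact k) * remainder_poly r b (h - 1 - k) u q" if k: "k < h" for k
  proof -
    let ?a = "h - k"
    let ?P = "permutations_of_set {?a<..<h+1}"
    let ?C' = "remainders r b (h - 1 - k) u"
    have setU: "{1..h} \<union> {b..b + u} = {?a<..<h+1} \<union> insert ?a ({1..h-1-k} \<union> {b..b+u})"
      using k hb by auto
    have "(\<Sum>ys | ys \<in> ?C \<and> k \<in> ?D ys. q ^ card (?D ys \<inter> {k<..})) =
        (\<Sum>(xs, ys)\<in>?P \<times> ?C'. q ^ card (blocks_below (h - 1 - k + 1) ys))"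
    proof (rule sum.reindex_bij_witness[where j = "\<lambda>zs. (take k zs, drop (Suc k) zs)"
          and i = "\<lambda>(xs, ys). xs @ ?a # ys"])
      fix zs assume "zs \<in> {ys \<in> ?C. k \<in> ?D ys}"
      then have zs: "set zs = {1..h} \<union> {b..b + u}" "distinct zs" "tail_rel r b zs"
        and D: "k < length zs" "zs ! k + k + 1 = h + 1" "set (take k zs) = {zs ! k<..<h + 1}"
        by (auto simp: remainders_def blocks_below_def permutations_of_set_def)
      have a: "zs ! k = ?a" using D by simp
      have eq: "zs = take k zs @ ?a # drop (Suc k) zs" using id_take_nth_drop[OF D(1)] a by simp
      show "(case (take k zs, drop (Suc k) zs) of (xs, ys) \<Rightarrow> xs @ ?a # ys) = zs" using eq by simp
      have d: "distinct (take k zs @ ?a # drop (Suc k) zs)" using zs(2) eq by simp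
      have s: "set (take k zs) = {?a<..<h+1}" using D(3) a by simp
      have "set zs = set (take k zs) \<union> insert ?a (set (drop (Suc k) zs))"
        by (subst eq) auto
      then have "{?a<..<h+1} \<union> insert ?a (set (drop (Suc k) zs)) =
          {?a<..<h+1} \<union> insert ?a ({1..h-1-k} \<union> {b..b+u})" using zs(1) setU s by simp
      moreover have "({?a<..<h+1} \<union> {?a}) \<inter> set (drop (Suc k) zs) = {}" using d s by auto
      moreover have "({?a<..<h+1} \<union> {?a}) \<inter> ({1..h-1-k} \<union> {b..b+u}) = {}" using k hb by auto
      ultimately have s2: "set (drop (Suc k) zs) = {1..h-1-k} \<union> {b..b+u}" by blast
      have "b \<notin> set (take (Suc k) zs)" using s a k hb D(1) by (auto simp: take_Suc_conv_app_nth)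
      then have v: "tail_rel r b (drop (Suc k) zs)" using tail_rel_drop zs(3) by blast
      show "(take k zs, drop (Suc k) zs) \<in> ?P \<times> ?C'"
        using s s2 v zs(2) by (simp add: remainders_def permutations_of_set_def)
      have "?D (take k zs @ ?a # drop (Suc k) zs) \<inter> {length (take k zs)<..} =
         (\<lambda>j. length (take k zs) + 1 + j) ` blocks_below ?a (drop (Suc k) zs)"
        by (rule blocks_below_after[OF d s]) (use D(1) k in simp)
      then have "?D zs \<inter> {k<..} = (\<lambda>j. k + 1 + j) ` blocks_below ?a (drop (Suc k) zs)"
        using eq D(1) by simp
      then have "card (?D zs \<inter> {k<..}) = card (blocks_below ?a (drop (Suc k) zs))"
        by (simp add: card_image inj_on_def)
      moreover have "h - 1 - k + 1 = ?a" using k by simp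
      ultimately show "(case (take k zs, drop (Suc k) zs) of (xs, ys) \<Rightarrow> q ^ card (blocks_below (h - 1 - k + 1) ys))
         = q ^ card (?D zs \<inter> {k<..})" by (simp only: prod.case)
    next
      fix p assume "p \<in> ?P \<times> ?C'"
      then obtain xs ys where p: "p = (xs, ys)" and xs: "set xs = {?a<..<h+1}" "distinct xs"
        and ys: "set ys = {1..h-1-k} \<union> {b..b+u}" "distinct ys" "tail_rel r b ys"
        by (auto simp: remainders_def permutations_of_set_def)
      have len: "length xs = k" using distinct_card[OF xs(2)] xs(1) k by simp
      show "(\<lambda>zs. (take k zs, drop (Suc k) zs)) ((\<lambda>(xs, ys). xs @ ?a # ys) p) = p"
        using len by (simp add: p)
      have "set (xs @ ?a # ys) = {1..h} \<union> {b..b+u}" using xs(1) ys(1) setU by simp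
      moreover have "distinct (xs @ ?a # ys)" using xs ys k hb by auto
      moreover have "tail_rel r b ((xs @ [?a]) @ ys)" using ys(3) by (rule tail_rel_appendI)
      moreover have "k \<in> ?D (xs @ ?a # ys)" unfolding blocks_below_def using len xs(1) k by (simp add: nth_append)
      ultimately show "(\<lambda>(xs, ys). xs @ ?a # ys) p \<in> {ys \<in> ?C. k \<in> ?D ys}"
        by (simp add: p remainders_def permutations_of_set_def)
    qed
    also have "\<dots> = of_nat (card ?P) * remainder_poly r b (h - 1 - k) u q"
      unfolding remainder_poly_def sum.cartesian_product[symmetric] by simp
    also have "of_nat (card ?P) = (of_nat (fact k) :: 'a)" using k by simp
    finally show ?thesis .
  qed
  have "remainder_poly r b h u q = (\<Sum>ys\<in>?C. 1 + (q - 1) * (\<Sum>k\<in>?D ys. q ^ card (?D ys \<inter> {k<..})))"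
    unfolding remainder_poly_def by (intro sum.cong refl power_card_expand) simp
  also have "\<dots> = of_nat (card ?C) + (q - 1) * (\<Sum>ys\<in>?C. \<Sum>k\<in>?D ys. q ^ card (?D ys \<inter> {k<..}))"
    by (simp add: sum.distrib sum_distrib_left)
  also have "(\<Sum>ys\<in>?C. \<Sum>k\<in>?D ys. q ^ card (?D ys \<inter> {k<..})) =
      (\<Sum>ys\<in>?C. \<Sum>k | k \<in> {..<h} \<and> k \<in> ?D ys. q ^ card (?D ys \<inter> {k<..}))"
    using sub by (intro sum.cong refl) blast
  also have "\<dots> = (\<Sum>k<h. \<Sum>ys | ys \<in> ?C \<and> k \<in> ?D ys. q ^ card (?D ys \<inter> {k<..}))"
    by (rule sum.swap_restrict) simp_all
  also have "\<dots> = (\<Sum>k<h. of_nat (fact k) * remainder_poly r b (h - 1 - k) u q)"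
    using inner by (intro sum.cong refl) simp
  finally show ?thesis .
qed

text \<open>
  A permutation with a marked occurrence at position \<open>k\<close> and first value \<open>a\<close> consists of an
  arrangement of \<open>a + 1, \<dots>, a + k\<close>, the entry \<open>a\<close>, and a remainder for \<open>b = a + k + 1\<close>. Its later
  occurrences are the extensions inside the remainder.
\<close>
lemma sum_power_occ_starts:
  fixes q :: "'a::comm_ring_1"
  assumes r: "one_sided r"
  shows "(\<Sum>zs\<in>permutations_of_set {1..n}. q ^ card (occ_starts r zs)) = of_nat (fact n) +
    (q - 1) * (\<Sum>k<n. \<Sum>a\<in>{1..<n - k}. of_nat (fact k) * remainder_poly r (a + k + 1) (a - 1) (n - (a + k + 1)) q)"
proof -
  let ?C = "permutations_of_set {1..n}"
  let ?E = "occ_starts r"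
  have inner: "(\<Sum>zs | (zs \<in> ?C \<and> k \<in> ?E zs) \<and> zs ! k = a. q ^ card (?E zs \<inter> {k<..})) =
      of_nat (fact k) * remainder_poly r (a + k + 1) (a - 1) (n - (a + k + 1)) q"
    if a: "1 \<le> a" "a + k + 1 \<le> n" for k a
  proof -
    let ?b = "a + k + 1"
    let ?P = "permutations_of_set {a<..<?b}"
    let ?C' = "remainders r ?b (a - 1) (n - ?b)"
    have setU: "{1..n} = {a<..<?b} \<union> insert a ({1..a - 1} \<union> {?b..?b + (n - ?b)})"
      using a by auto
    have "(\<Sum>zs | (zs \<in> ?C \<and> k \<in> ?E zs) \<and> zs ! k = a. q ^ card (?E zs \<inter> {k<..})) =
        (\<Sum>(xs, ys)\<in>?P \<times> ?C'. q ^ card (blocks_below (a - 1 + 1) ys))"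
    proof (rule sum.reindex_bij_witness[where j = "\<lambda>zs. (take k zs, drop (Suc k) zs)"
          and i = "\<lambda>(xs, ys). xs @ a # ys"])
      fix zs assume "zs \<in> {zs. (zs \<in> ?C \<and> k \<in> ?E zs) \<and> zs ! k = a}"
      then have zs: "set zs = {1..n}" "distinct zs"
        and D: "k < length zs" "set (take k zs) = {a<..<?b}"
        and v: "tail_rel r ?b (drop (Suc k) zs)" and ak: "zs ! k = a"
        by (auto simp: occ_starts_def permutations_of_set_def)
      have eq: "zs = take k zs @ a # drop (Suc k) zs" using id_take_nth_drop[OF D(1)] ak by simp
      show "(case (take k zs, drop (Suc k) zs) of (xs, ys) \<Rightarrow> xs @ a # ys) = zs" using eq by simp
      have d: "distinct (take k zs @ a # drop (Suc k) zs)" using zs(2) eq by simp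
      have "set zs = set (take k zs) \<union> insert a (set (drop (Suc k) zs))"
        by (subst eq) auto
      then have "{a<..<?b} \<union> insert a (set (drop (Suc k) zs)) =
          {a<..<?b} \<union> insert a ({1..a - 1} \<union> {?b..?b + (n - ?b)})" using zs(1) setU D(2) by simp
      moreover have "({a<..<?b} \<union> {a}) \<inter> set (drop (Suc k) zs) = {}" using d D(2) by auto
      moreover have "({a<..<?b} \<union> {a}) \<inter> ({1..a - 1} \<union> {?b..?b + (n - ?b)}) = {}" using a by auto
      ultimately have s2: "set (drop (Suc k) zs) = {1..a - 1} \<union> {?b..?b + (n - ?b)}" by blast
      show "(take k zs, drop (Suc k) zs) \<in> ?P \<times> ?C'"
        using D(2) s2 v zs(2) by (simp add: remainders_def permutations_of_set_def)
      have "?E (take k zs @ a # drop (Suc k) zs) \<inter> {length (take k zs)<..} =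
         (\<lambda>j. length (take k zs) + 1 + j) ` blocks_below a (drop (Suc k) zs)"
        by (rule occ_starts_after[OF r d D(2) _ v]) (use D(1) in simp)
      then have "?E zs \<inter> {k<..} = (\<lambda>j. k + 1 + j) ` blocks_below a (drop (Suc k) zs)"
        using eq D(1) by simp
      then have "card (?E zs \<inter> {k<..}) = card (blocks_below a (drop (Suc k) zs))"
        by (simp add: card_image inj_on_def)
      moreover have "a - 1 + 1 = a" using a by simp
      ultimately show "(case (take k zs, drop (Suc k) zs) of (xs, ys) \<Rightarrow> q ^ card (blocks_below (a - 1 + 1) ys))
         = q ^ card (?E zs \<inter> {k<..})" by (simp only: prod.case)
    next
      fix p assume "p \<in> ?P \<times> ?C'"
      then obtain xs ys where p: "p = (xs, ys)" and xs: "set xs = {a<..<?b}" "distinct xs"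
        and ys: "set ys = {1..a - 1} \<union> {?b..?b + (n - ?b)}" "distinct ys" "tail_rel r ?b ys"
        by (auto simp: remainders_def permutations_of_set_def)
      have len: "length xs = k" using distinct_card[OF xs(2)] xs(1) by simp
      show "(\<lambda>zs. (take k zs, drop (Suc k) zs)) ((\<lambda>(xs, ys). xs @ a # ys) p) = p"
        using len by (simp add: p)
      have "set (xs @ a # ys) = {1..n}" using xs(1) ys(1) setU by simp
      moreover have "distinct (xs @ a # ys)" using xs ys a by auto
      moreover have "k \<in> ?E (xs @ a # ys)" unfolding occ_starts_def using len xs(1) ys(3) by (simp add: nth_append)
      moreover have "(xs @ a # ys) ! k = a" using len by (simp add: nth_append)
      ultimately show "(\<lambda>(xs, ys). xs @ a # ys) p \<in> {zs. (zs \<in> ?C \<and> k \<in> ?E zs) \<and> zs ! k = a}"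
        by (simp add: p permutations_of_set_def)
    qed
    also have "\<dots> = of_nat (card ?P) * remainder_poly r ?b (a - 1) (n - ?b) q"
      unfolding remainder_poly_def sum.cartesian_product[symmetric] by simp
    also have "of_nat (card ?P) = (of_nat (fact k) :: 'a)" by simp
    finally show ?thesis .
  qed
  have sub: "k < n" if "zs \<in> ?C" "k \<in> ?E zs" for zs k
    using that length_finite_permutations_of_set[of zs "{1..n}"] by (auto simp: occ_starts_def)
  have rng: "zs ! k \<in> {1..<n - k}" if "zs \<in> ?C" "k \<in> ?E zs" for zs k
  proof -
    have "zs ! k + k + 1 \<in> set (drop (Suc k) zs)"
      using that(2) tail_rel_in_set by (auto simp: occ_starts_def)
    then have "zs ! k + k + 1 \<in> set zs" by (rule in_set_dropD)
    moreover have "zs ! k \<in> set zs" using that(2) by (auto simp: occ_starts_def)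
    ultimately show ?thesis using that(1) by (auto simp: permutations_of_set_def)
  qed
  have "(\<Sum>zs\<in>?C. q ^ card (?E zs)) = (\<Sum>zs\<in>?C. 1 + (q - 1) * (\<Sum>k\<in>?E zs. q ^ card (?E zs \<inter> {k<..})))"
    by (intro sum.cong refl power_card_expand) simp
  also have "\<dots> = of_nat (fact n) + (q - 1) * (\<Sum>zs\<in>?C. \<Sum>k\<in>?E zs. q ^ card (?E zs \<inter> {k<..}))"
    by (simp add: sum.distrib sum_distrib_left)
  also have "(\<Sum>zs\<in>?C. \<Sum>k\<in>?E zs. q ^ card (?E zs \<inter> {k<..})) =
      (\<Sum>zs\<in>?C. \<Sum>k | k \<in> {..<n} \<and> k \<in> ?E zs. q ^ card (?E zs \<inter> {k<..}))"
    using sub by (intro sum.cong refl) blast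
  also have "\<dots> = (\<Sum>k<n. \<Sum>zs | zs \<in> ?C \<and> k \<in> ?E zs. q ^ card (?E zs \<inter> {k<..}))"
    by (rule sum.swap_restrict) simp_all
  also have "\<dots> = (\<Sum>k<n. \<Sum>a\<in>{1..<n - k}. of_nat (fact k) * remainder_poly r (a + k + 1) (a - 1) (n - (a + k + 1)) q)"
  proof (rule sum.cong[OF refl])
    fix k
    have "(\<Sum>zs | zs \<in> ?C \<and> k \<in> ?E zs. q ^ card (?E zs \<inter> {k<..})) =
      (\<Sum>a\<in>{1..<n - k}. \<Sum>zs | zs \<in> {zs. zs \<in> ?C \<and> k \<in> ?E zs} \<and> zs ! k = a. q ^ card (?E zs \<inter> {k<..}))"
      by (rule sum.group[symmetric]) (use rng in auto)
    also have "\<dots> = (\<Sum>a\<in>{1..<n - k}. of_nat (fact k) * remainder_poly r (a + k + 1) (a - 1) (n - (a + k + 1)) q)"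
      by (intro sum.cong refl) (simp only: mem_Collect_eq, rule inner, auto)
    finally show "(\<Sum>zs | zs \<in> ?C \<and> k \<in> ?E zs. q ^ card (?E zs \<inter> {k<..})) =
      (\<Sum>a\<in>{1..<n - k}. of_nat (fact k) * remainder_poly r (a + k + 1) (a - 1) (n - (a + k + 1)) q)" .
  qed
  finally show ?thesis .
qed

section \<open>Counting remainders\<close>

definition last_among :: "'a set \<Rightarrow> 'a \<Rightarrow> 'a list \<Rightarrow> bool" where
  "last_among Z b ys \<longleftrightarrow> (\<exists>us vs. ys = us @ b # vs \<and> set vs \<inter> Z = {})"

lemma last_among_map:
  assumes "last_among Z b ys" "inj f"
  shows "last_among (f ` Z) (f b) (map f ys)"
proof -
  obtain us vs where "ys = us @ b # vs" "set vs \<inter> Z = {}"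
    using assms(1) by (auto simp: last_among_def)
  then have "map f ys = map f us @ f b # map f vs" "set (map f vs) \<inter> f ` Z = {}"
    using assms(2) by (auto simp: inj_def)
  then show ?thesis unfolding last_among_def by blast
qed

lemma last_among_eq_last_filter:
  assumes "last_among Z b ys" "b \<in> Z"
  shows "b = last (filter (\<lambda>x. x \<in> Z) ys)"
proof -
  obtain us vs where 1: "ys = us @ b # vs" "set vs \<inter> Z = {}"
    using assms(1) by (auto simp: last_among_def)
  have "filter (\<lambda>x. x \<in> Z) vs = []" using 1(2) by (auto simp: filter_empty_conv)
  then show ?thesis using 1(1) assms(2) by simp
qed

text \<open>
  Exchanging two elements of \<open>Z\<close> shows that each of them is equally often the last entry from \<open>Z\<close>,
  and every arrangement has exactly one such entry.
\<close>
lemma card_last_among: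
  assumes "finite X" "Z \<subseteq> X" "b \<in> Z"
  shows "card Z * card {ys \<in> permutations_of_set X. last_among Z b ys} = fact (card X)"
proof -
  let ?A = "\<lambda>b. {ys \<in> permutations_of_set X. last_among Z b ys}"
  have eq: "card (?A c) \<le> card (?A b)" if "b \<in> Z" "c \<in> Z" for b c
  proof -
    let ?f = "transpose b c"
    have fX: "?f ` X = X" and fZ: "?f ` Z = Z"
      using that assms(2) by (auto intro!: permutes_image permutes_swap_id)
    have sub: "map ?f ` ?A c \<subseteq> ?A b"
    proof
      fix ys assume "ys \<in> map ?f ` ?A c"
      then obtain zs where zs: "ys = map ?f zs" "set zs = X" "distinct zs" "last_among Z c zs"
        by (auto simp: permutations_of_set_def)
      have "last_among (?f ` Z) (?f c) (map ?f zs)" by (rule last_among_map[OF zs(4)]) simp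
      then show "ys \<in> ?A b" using zs fX fZ
        by (auto simp: permutations_of_set_def distinct_map)
    qed
    have "card (map ?f ` ?A c) = card (?A c)"
      by (rule card_image[OF inj_on_subset[OF inj_mapI]]) simp_all
    moreover have "card (map ?f ` ?A c) \<le> card (?A b)"
      by (rule card_mono[OF _ sub]) simp
    ultimately show ?thesis by simp
  qed
  have const: "card (?A c) = card (?A b)" if "c \<in> Z" for c
    using eq[OF that assms(3)] eq[OF assms(3) that] by simp
  have un: "permutations_of_set X = (\<Union>c\<in>Z. ?A c)"
  proof
    show "permutations_of_set X \<subseteq> (\<Union>c\<in>Z. ?A c)"
    proof
      fix ys assume ys: "ys \<in> permutations_of_set X"
      then have "\<exists>x\<in>set ys. x \<in> Z" using assms by (auto simp: permutations_of_set_def)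
      then obtain us c vs where "ys = us @ c # vs" "c \<in> Z" "\<forall>v\<in>set vs. v \<notin> Z"
        using split_list_last_prop[of ys "\<lambda>x. x \<in> Z"] by metis
      then show "ys \<in> (\<Union>c\<in>Z. ?A c)" using ys by (auto simp: last_among_def)
    qed
  qed auto
  have "fact (card X) = card (permutations_of_set X)" using assms by simp
  also have "\<dots> = (\<Sum>c\<in>Z. card (?A c))"
  proof (subst un, rule card_UN_disjoint)
    show "finite Z" using assms finite_subset by auto
    show "\<forall>c\<in>Z. finite (?A c)" by simp
    show "\<forall>c\<in>Z. \<forall>d\<in>Z. c \<noteq> d \<longrightarrow> ?A c \<inter> ?A d = {}"
    proof clarify
      fix c d assume cd: "c \<in> Z" "d \<in> Z" "c \<noteq> d"
      have False if "last_among Z c ys" "last_among Z d ys" for ys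
        using last_among_eq_last_filter[OF that(1) cd(1)] last_among_eq_last_filter[OF that(2) cd(2)] cd(3)
        by simp
      then show "?A c \<inter> ?A d = {}" by auto
    qed
  qed
  also have "\<dots> = card Z * card (?A b)" using const by simp
  finally show ?thesis by simp
qed

lemma tail_rel_last_among:
  assumes "distinct ys" "\<And>x. x \<in> set ys \<Longrightarrow> x \<noteq> b \<Longrightarrow> r x b \<longleftrightarrow> x \<notin> Z"
  shows "tail_rel r b ys \<longleftrightarrow> last_among Z b ys"
proof -
  have "(\<forall>v\<in>set vs. r v b) \<longleftrightarrow> set vs \<inter> Z = {}" if ys: "ys = us @ b # vs" for us vs
  proof -
    have "r v b \<longleftrightarrow> v \<notin> Z" if "v \<in> set vs" for v
      by (rule assms(2)) (use that ys assms(1) in auto)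
    then show ?thesis by auto
  qed
  then show ?thesis unfolding tail_rel_def last_among_def by (intro ex_cong1 conj_cong refl)
qed

text \<open>
  For \<open>(<)\<close> the entries after \<open>b\<close> must be small, so \<open>b\<close> is last among itself and the \<open>u\<close> larger
  values; for \<open>(>)\<close> it is last among itself and the \<open>h\<close> smaller ones.
\<close>
lemma card_remainders:
  assumes hb: "h < b" and r: "r = (<) \<or> r = (>)"
  shows "(if r = (<) then u + 1 else h + 1) * card (remainders r b h u) = fact (h + u + 1)"
proof -
  let ?X = "{1..h} \<union> {b..b + u}"
  \<comment> \<open>The elements that must not come after \<open>b\<close>.\<close>
  let ?Z = "if r = (<) then {b..b + u} else insert b {1..h}"
  have ne: "(<) \<noteq> ((>) :: nat \<Rightarrow> nat \<Rightarrow> bool)" by (auto simp: fun_eq_iff)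
  have cX: "card ?X = h + u + 1" using hb by (subst card_Un_disjoint) auto
  have cZ: "card ?Z = (if r = (<) then u + 1 else h + 1)" using hb by auto
  have "remainders r b h u = {ys \<in> permutations_of_set ?X. last_among ?Z b ys}"
    unfolding remainders_def
  proof (intro Collect_cong conj_cong refl tail_rel_last_among)
    fix ys x assume ys: "ys \<in> permutations_of_set ?X"
    show "distinct ys" using ys by (rule permutations_of_setD)
    assume "x \<in> set ys" "x \<noteq> b"
    then have "x \<in> ?X" "x \<noteq> b" using permutations_of_setD(1)[OF ys] by blast+
    then show "r x b \<longleftrightarrow> x \<notin> ?Z" using r ne hb by auto
  qed
  moreover have "card ?Z * card {ys \<in> permutations_of_set ?X. last_among ?Z b ys} = fact (card ?X)"
    by (rule card_last_among) (use hb in auto)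
  ultimately show ?thesis using cX cZ by simp
qed

text \<open>
  The number of remainders depends on \<open>h\<close> and \<open>u\<close> only, and the recursion keeps \<open>b\<close> fixed, so the
  weighted sums do not depend on \<open>b\<close> either. This replaces the renumbering of values.
\<close>
lemma remainder_poly_indep:
  fixes q :: "'a::comm_ring_1"
  assumes r: "r = (<) \<or> r = (>)"
  shows "h < b \<Longrightarrow> h < b' \<Longrightarrow> remainder_poly r b h u q = remainder_poly r b' h u q"
proof (induction h rule: less_induct)
  case (less h)
  have "(if r = (<) then u + 1 else h + 1) * card (remainders r b h u) =
        (if r = (<) then u + 1 else h + 1) * card (remainders r b' h u)"
    using card_remainders[OF less.prems(1) r] card_remainders[OF less.prems(2) r] by simp
  then have 1: "card (remainders r b h u) = card (remainders r b' h u)" by (auto split: if_splits)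
  have "remainder_poly r b (h - 1 - k) u q = remainder_poly r b' (h - 1 - k) u q" if "k < h" for k
    using that less by auto
  then show ?case unfolding remainder_poly_rec[OF less.prems(1)] remainder_poly_rec[OF less.prems(2)] 1
    by auto
qed

section \<open>From mesh occurrences to blocks\<close>

definition one_line :: "nat \<Rightarrow> (nat \<Rightarrow> nat) \<Rightarrow> nat list" where
  "one_line n \<sigma> = map \<sigma> [1..<Suc n]"

lemma bij_betw_one_line:
  "bij_betw (one_line n) {\<sigma>. \<sigma> permutes {1..n}} (permutations_of_set {1..n})"
proof -
  let ?P = "{\<sigma>. \<sigma> permutes {1..n}}"
  have inj: "inj_on (one_line n) ?P"
  proof (rule inj_onI)
    fix \<sigma> \<tau> assume a: "\<sigma> \<in> ?P" "\<tau> \<in> ?P" "one_line n \<sigma> = one_line n \<tau>"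
    then have "\<forall>x\<in>{1..n}. \<sigma> x = \<tau> x" by (auto simp: one_line_def simp del: upt_Suc)
    then show "\<sigma> = \<tau>" using a(1,2) by (auto simp: permutes_def fun_eq_iff)
  qed
  have sub: "one_line n ` ?P \<subseteq> permutations_of_set {1..n}"
  proof
    fix zs assume "zs \<in> one_line n ` ?P"
    then obtain \<sigma> where s: "\<sigma> permutes {1..n}" "zs = one_line n \<sigma>" by auto
    have e: "set [1..<Suc n] = {1..n}" by auto
    have "set zs = {1..n}" using permutes_image[OF s(1)] e by (simp add: s(2) one_line_def del: upt_Suc)
    moreover have "distinct zs"
      using permutes_inj_on[OF s(1)] by (simp add: s(2) one_line_def distinct_map del: upt_Suc)
    ultimately show "zs \<in> permutations_of_set {1..n}" by (rule permutations_of_setI)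
  qed
  have "card (one_line n ` ?P) = card (permutations_of_set {1..n})"
    using card_image[OF inj] card_permutations[of "{1..n}" n] by simp
  then show ?thesis using inj sub by (simp add: bij_betw_def card_subset_eq)
qed

lemma F_biv_nth: "F_biv R $ n = (\<Sum>\<sigma> | \<sigma> permutes {1..n}. [:0, 1:] ^ occurrences R n \<sigma>)"
proof (rule poly_eqI)
  fix k
  have fin: "finite {\<sigma>. \<sigma> permutes {1..n}}" by (rule finite_permutations) simp
  have "(\<Sum>\<sigma> | \<sigma> permutes {1..n}. if occurrences R n \<sigma> = k then 1 else 0) =
      int (card {\<sigma> \<in> {\<sigma>. \<sigma> permutes {1..n}}. occurrences R n \<sigma> = k})"
    using fin by (simp add: sum.If_cases Int_def)
  then show "coeff (F_biv R $ n) k = coeff (\<Sum>\<sigma> | \<sigma> permutes {1..n}. [:0, 1:] ^ occurrences R n \<sigma>) k"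
    by (simp add: coeff_F_biv s_count_def coeff_sum monom_altdef[of 1, simplified, symmetric])
qed

text \<open>
  The representatives of the two symmetry classes are obtained for \<open>y = 0\<close> and \<open>y = 2\<close>.
\<close>
definition canonical_mesh :: "nat \<Rightarrow> (nat \<times> nat) set" where
  "canonical_mesh y = {(0,0), (0,2), (1,1), (2,1), (2,y)}"

lemma is_occurrence_canonical_unfold:
  assumes "y = 0 \<or> y = 2"
  shows "is_occurrence (canonical_mesh y) n \<sigma> (i1, i2) \<longleftrightarrow>
    (i1 \<in> {1..n} \<and> i2 \<in> {1..n} \<and> i1 < i2 \<and> \<sigma> i1 < \<sigma> i2) \<and>
    \<not> (\<exists>l\<in>{1..n}. 0 < l \<and> l < i1 \<and> 0 < \<sigma> l \<and> \<sigma> l < \<sigma> i1) \<and>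
    \<not> (\<exists>l\<in>{1..n}. 0 < l \<and> l < i1 \<and> \<sigma> i2 < \<sigma> l \<and> \<sigma> l < n + 1) \<and>
    \<not> (\<exists>l\<in>{1..n}. i1 < l \<and> l < i2 \<and> \<sigma> i1 < \<sigma> l \<and> \<sigma> l < \<sigma> i2) \<and>
    \<not> (\<exists>l\<in>{1..n}. i2 < l \<and> l < n + 1 \<and> \<sigma> i1 < \<sigma> l \<and> \<sigma> l < \<sigma> i2) \<and>
    \<not> (\<exists>l\<in>{1..n}. i2 < l \<and> l < n + 1 \<and> (if y = 0 then 0 else \<sigma> i2) < \<sigma> l \<and> \<sigma> l < (if y = 0 then \<sigma> i1 else n + 1))"
proof -
  have nth: "[a, b, c, d] ! 0 = a" "[a, b, c, d] ! 1 = b" "[a, b, c, d] ! 2 = c" "[a, b, c, d] ! (0 + 1) = b"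
      "[a, b, c, d] ! (1 + 1) = c" "[a, b, c, d] ! (2 + 1) = d" for a b c d :: nat
    by (simp_all add: numeral_eq_Suc)
  have y: "[a, b, c, d] ! y = (if y = 0 then a else c)" "[a, b, c, d] ! (y + 1) = (if y = 0 then b else d)"
    for a b c d :: nat
    using assms by (auto simp: numeral_eq_Suc)
  show ?thesis
    unfolding is_occurrence_def canonical_mesh_def Let_def prod.case ball_simps nth y
    by (simp only: simp_thms conj_assoc)
qed

text \<open>
  Cells \<open>(0,0)\<close> and \<open>(0,2)\<close> confine the entries left of \<open>i1\<close> to the values between the two points,
  cells \<open>(1,1)\<close> and \<open>(2,1)\<close> keep these values from occurring anywhere else. Together they make the prefix a
  block, and counting its entries gives the second value.
\<close>
lemma is_occurrence_canonical:
  assumes s: "\<sigma> permutes {1..n}" and y: "y = 0 \<or> y = 2"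
  shows "is_occurrence (canonical_mesh y) n \<sigma> (i1, i2) \<longleftrightarrow>
    1 \<le> i1 \<and> i1 < i2 \<and> i2 \<le> n \<and> \<sigma> i2 = \<sigma> i1 + i1 \<and> \<sigma> ` {1..<i1} = {\<sigma> i1<..<\<sigma> i2} \<and>
    (\<forall>l\<in>{i2<..n}. if y = 0 then \<sigma> i2 < \<sigma> l else \<sigma> l < \<sigma> i2)"
    (is "?L \<longleftrightarrow> ?R")
proof -
  have inj: "\<sigma> a = \<sigma> b \<longleftrightarrow> a = b" for a b using permutes_inj[OF s] by (auto simp: inj_def)
  have rng: "\<sigma> l \<in> {1..n} \<longleftrightarrow> l \<in> {1..n}" for l using permutes_in_image[OF s] .
  note unf = is_occurrence_canonical_unfold[OF y]
  have bnd: "0 < l" "l < n + 1" "0 < \<sigma> l" "\<sigma> l < n + 1" if "l \<in> {1..n}" for l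
    using that rng[of l] by auto
  show ?thesis
  proof
    assume L: ?L
    note L' = L[unfolded unf]
    have i: "i1 \<in> {1..n}" "i2 \<in> {1..n}" "i1 < i2" "\<sigma> i1 < \<sigma> i2" using L' by simp_all
    have c00: "\<not> \<sigma> l < \<sigma> i1" if "l \<in> {1..n}" "l < i1" for l
      using L'[THEN conjunct2, THEN conjunct1] bnd[OF that(1)] that by blast
    have c02: "\<not> \<sigma> i2 < \<sigma> l" if "l \<in> {1..n}" "l < i1" for l
      using L'[THEN conjunct2, THEN conjunct2, THEN conjunct1] bnd[OF that(1)] that by blast
    have c11: "\<not> (\<sigma> i1 < \<sigma> l \<and> \<sigma> l < \<sigma> i2)" if "l \<in> {1..n}" "i1 < l" "l < i2" for l
      using L'[THEN conjunct2, THEN conjunct2, THEN conjunct2, THEN conjunct1] that by blast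
    have c21: "\<not> (\<sigma> i1 < \<sigma> l \<and> \<sigma> l < \<sigma> i2)" if "l \<in> {1..n}" "i2 < l" for l
      using L'[THEN conjunct2, THEN conjunct2, THEN conjunct2, THEN conjunct2, THEN conjunct1] bnd[OF that(1)] that by blast
    have c2y: "if y = 0 then \<not> \<sigma> l < \<sigma> i1 else \<not> \<sigma> i2 < \<sigma> l" if "l \<in> {1..n}" "i2 < l" for l
      using L'[THEN conjunct2, THEN conjunct2, THEN conjunct2, THEN conjunct2, THEN conjunct2] bnd[OF that(1)] that
      by (cases "y = 0") auto
    have im: "\<sigma> ` {1..<i1} = {\<sigma> i1<..<\<sigma> i2}"
    proof
      show "\<sigma> ` {1..<i1} \<subseteq> {\<sigma> i1<..<\<sigma> i2}"
      proof
        fix w assume "w \<in> \<sigma> ` {1..<i1}"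
        then obtain l where l: "l \<in> {1..<i1}" "w = \<sigma> l" by auto
        then have "l \<in> {1..n}" using i by auto
        then have "\<not> \<sigma> l < \<sigma> i1" "\<not> \<sigma> i2 < \<sigma> l" using c00[of l] c02[of l] l by auto
        moreover have "\<sigma> l \<noteq> \<sigma> i1" "\<sigma> l \<noteq> \<sigma> i2" using inj l i by auto
        ultimately show "w \<in> {\<sigma> i1<..<\<sigma> i2}" using l by auto
      qed
      show "{\<sigma> i1<..<\<sigma> i2} \<subseteq> \<sigma> ` {1..<i1}"
      proof
        fix w assume w: "w \<in> {\<sigma> i1<..<\<sigma> i2}"
        have "\<sigma> i2 \<in> {1..n}" "\<sigma> i1 \<in> {1..n}" using i(1,2) by (simp_all only: rng)
        then have "w \<in> {1..n}" using w by auto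
        then have "w \<in> \<sigma> ` {1..n}" by (simp only: permutes_image[OF s])
        then obtain l where l: "l \<in> {1..n}" "w = \<sigma> l" by blast
        have "l \<noteq> i1" "l \<noteq> i2" using w l by auto
        then have "l < i1" using c11[OF l(1)] c21[OF l(1)] w l by (meson greaterThanLessThan_iff nat_neq_iff)
        then show "w \<in> \<sigma> ` {1..<i1}" using l by auto
      qed
    qed
    have "card (\<sigma> ` {1..<i1}) = i1 - 1" using permutes_inj_on[OF s] by (simp add: card_image)
    then have "\<sigma> i2 = \<sigma> i1 + i1" using im i by auto
    moreover have "if y = 0 then \<sigma> i2 < \<sigma> l else \<sigma> l < \<sigma> i2" if l: "l \<in> {i2<..n}" for l
    proof -
      have l': "l \<in> {1..n}" "i2 < l" using l by auto
      have "\<sigma> l \<noteq> \<sigma> i1" "\<sigma> l \<noteq> \<sigma> i2" using inj l i by auto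
      then show ?thesis using c21[OF l'] c2y[OF l'] by (auto split: if_splits)
    qed
    ultimately show ?R using i im by auto
  next
    assume R: ?R
    have lt: "\<sigma> i1 < \<sigma> i2" using R by auto
    have mid: "l \<in> {1..<i1}" if "\<sigma> l \<in> {\<sigma> i1<..<\<sigma> i2}" for l
    proof -
      have "\<sigma> l \<in> \<sigma> ` {1..<i1}" using that R by simp
      then show ?thesis using inj by auto
    qed
    have bef: "\<sigma> i1 < \<sigma> l \<and> \<sigma> l < \<sigma> i2" if "1 \<le> l" "l < i1" for l
    proof -
      have "\<sigma> l \<in> \<sigma> ` {1..<i1}" using that by auto
      then show ?thesis using R by auto
    qed
    have aft: "if y = 0 then \<sigma> i2 < \<sigma> l else \<sigma> l < \<sigma> i2" if "i2 < l" "l \<le> n" for l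
      using R that by auto
    have i12: "i1 < i2" using R by blast
    have "\<not> (0 < l \<and> l < i1 \<and> 0 < \<sigma> l \<and> \<sigma> l < \<sigma> i1)"
      "\<not> (0 < l \<and> l < i1 \<and> \<sigma> i2 < \<sigma> l \<and> \<sigma> l < n + 1)" if "l \<in> {1..n}" for l
      using bef[of l] by linarith+
    moreover have "\<not> (i1 < l \<and> l < i2 \<and> \<sigma> i1 < \<sigma> l \<and> \<sigma> l < \<sigma> i2)"
      "\<not> (i2 < l \<and> l < n + 1 \<and> \<sigma> i1 < \<sigma> l \<and> \<sigma> l < \<sigma> i2)" for l
      using mid[of l] i12 unfolding greaterThanLessThan_iff atLeastLessThan_iff by linarith+
    moreover have "\<not> (i2 < l \<and> l < n + 1 \<and> (if y = 0 then 0 else \<sigma> i2) < \<sigma> l \<and> \<sigma> l < (if y = 0 then \<sigma> i1 else n + 1))" for l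
      using aft[of l] lt by (cases "y = 0") auto
    moreover have "i1 \<in> {1..n}" "i2 \<in> {1..n}" "i1 < i2" "\<sigma> i1 < \<sigma> i2" using R lt by auto
    ultimately show ?L unfolding unf by blast
  qed
qed

lemma tail_rel_map_upt:
  "tail_rel r b (map f [a..<c]) \<longleftrightarrow> (\<exists>i. a \<le> i \<and> i < c \<and> f i = b \<and> (\<forall>l\<in>{i<..<c}. r (f l) b))"
proof
  assume "tail_rel r b (map f [a..<c])"
  then obtain us vs where 1: "map f [a..<c] = us @ b # vs" "\<forall>v\<in>set vs. r v b"
    by (auto simp: tail_rel_def)
  define i where "i = a + length us"
  have len: "c - a = length us + 1 + length vs" using arg_cong[OF 1(1), of length] by simp
  have "map f [a..<c] ! length us = b" using 1(1) by simp
  then have fi: "f i = b" using len by (simp add: i_def)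
  moreover have "r (f l) b" if l: "l \<in> {i<..<c}" for l
  proof -
    have "drop (Suc (length us)) (map f [a..<c]) = vs" using 1(1) by simp
    then have "vs = map f [i + 1..<c]" by (simp add: drop_map i_def)
    then show ?thesis using 1(2) l by auto
  qed
  ultimately show "\<exists>i. a \<le> i \<and> i < c \<and> f i = b \<and> (\<forall>l\<in>{i<..<c}. r (f l) b)"
    using len by (intro exI[of _ i]) (auto simp: i_def)
next
  assume "\<exists>i. a \<le> i \<and> i < c \<and> f i = b \<and> (\<forall>l\<in>{i<..<c}. r (f l) b)"
  then obtain i where i: "a \<le> i" "i < c" "f i = b" "\<forall>l\<in>{i<..<c}. r (f l) b" by auto
  have "[a..<c] = [a..<i] @ i # [Suc i..<c]" using i(1,2)
    using upt_add_eq_append[of a i "c - i"] by (simp add: upt_conv_Cons)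
  then have "map f [a..<c] = map f [a..<i] @ b # map f [Suc i..<c]" using i(3) by simp
  then show "tail_rel r b (map f [a..<c])" unfolding tail_rel_def using i(4) by fastforce
qed

text \<open>
  The first position determines the occurrence, because it determines the value of the second point.
\<close>
lemma occurrences_canonical:
  assumes s: "\<sigma> permutes {1..n}" and y: "y = 0 \<or> y = 2"
  shows "occurrences (canonical_mesh y) n \<sigma> = card (occ_starts (if y = 0 then (>) else (<)) (one_line n \<sigma>))"
proof -
  let ?r = "(if y = 0 then (>) else (<)) :: nat \<Rightarrow> nat \<Rightarrow> bool"
  let ?zs = "one_line n \<sigma>"
  let ?O = "{p. is_occurrence (canonical_mesh y) n \<sigma> p}"
  note iff = is_occurrence_canonical[OF s y]
  have len: "length ?zs = n" by (simp add: one_line_def)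
  have nth: "?zs ! k = \<sigma> (k + 1)" if "k < n" for k using that by (simp add: one_line_def del: upt_Suc)
  have tk: "set (take k ?zs) = \<sigma> ` {1..<k + 1}" if "k < n" for k
    using that by (simp add: one_line_def take_map take_upt del: upt_Suc)
  have dr: "drop (Suc k) ?zs = map \<sigma> [k + 2..<Suc n]" for k
    by (simp add: one_line_def drop_map del: upt_Suc)
  have mem: "k \<in> occ_starts ?r ?zs \<longleftrightarrow> (\<exists>i2. is_occurrence (canonical_mesh y) n \<sigma> (k + 1, i2))" for k
  proof (cases "k < n")
    case True
    have ivl: "{i<..<Suc n} = {i<..n}" for i by auto
    have "(\<sigma> ` {1..<k + 1} = {\<sigma> (k + 1)<..<\<sigma> (k + 1) + k + 1} \<and>
        k + 2 \<le> i \<and> i < Suc n \<and> \<sigma> i = \<sigma> (k + 1) + k + 1 \<and> (\<forall>l\<in>{i<..n}. ?r (\<sigma> l) (\<sigma> (k + 1) + k + 1))) \<longleftrightarrow>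
      is_occurrence (canonical_mesh y) n \<sigma> (k + 1, i)" for i
      unfolding iff by (cases "\<sigma> i = \<sigma> (k + 1) + k + 1") auto
    then show ?thesis
      unfolding occ_starts_def mem_Collect_eq len nth[OF True] tk[OF True] dr tail_rel_map_upt ivl
      using True by blast
  next
    case False
    then show ?thesis unfolding occ_starts_def mem_Collect_eq len iff by auto
  qed
  have "bij_betw (\<lambda>(i1, i2). i1 - 1) ?O (occ_starts ?r ?zs)"
  proof (rule bij_betw_imageI)
    show "inj_on (\<lambda>(i1, i2). i1 - 1) ?O"
    proof (rule inj_onI, clarsimp simp: iff)
      fix i1 i2 j1 j2
      assume a: "Suc 0 \<le> i1" "Suc 0 \<le> j1" "i1 - Suc 0 = j1 - Suc 0" "\<sigma> i2 = \<sigma> i1 + i1" "\<sigma> j2 = \<sigma> j1 + j1"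
      then have "i1 = j1" by simp
      moreover from this have "\<sigma> i2 = \<sigma> j2" using a by simp
      then have "i2 = j2" using permutes_inj[OF s] by (auto simp: inj_def)
      ultimately show "i1 = j1 \<and> i2 = j2" by simp
    qed
    show "(\<lambda>(i1, i2). i1 - 1) ` ?O = occ_starts ?r ?zs"
    proof (intro equalityI subsetI)
      fix k assume "k \<in> (\<lambda>(i1, i2). i1 - 1) ` ?O"
      then obtain i1 i2 where o: "is_occurrence (canonical_mesh y) n \<sigma> (i1, i2)" "k = i1 - 1" by auto
      then have "i1 = k + 1" using iff by simp
      then show "k \<in> occ_starts ?r ?zs" using mem o by blast
    next
      fix k assume "k \<in> occ_starts ?r ?zs"
      then obtain i2 where "is_occurrence (canonical_mesh y) n \<sigma> (k + 1, i2)" using mem by blast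
      then show "k \<in> (\<lambda>(i1, i2). i1 - 1) ` ?O" by (intro image_eqI[of _ _ "(k + 1, i2)"]) auto
    qed
  qed
  then show ?thesis unfolding occurrences_def by (rule bij_betw_same_card)
qed

lemma F_biv_canonical:
  assumes "y = 0 \<or> y = 2"
  shows "F_biv (canonical_mesh y) $ n =
    (\<Sum>zs\<in>permutations_of_set {1..n}. [:0, 1:] ^ card (occ_starts (if y = 0 then (>) else (<)) zs))"
  unfolding F_biv_nth
  by (subst sum.reindex_bij_betw[OF bij_betw_one_line, symmetric], rule sum.cong)
    (simp_all add: occurrences_canonical[OF _ assms])

section \<open>Symmetries of mesh patterns\<close>

lemma s_count_bij:
  assumes "bij_betw f {\<sigma>. \<sigma> permutes {1..n}} {\<sigma>. \<sigma> permutes {1..n}}"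
    and "\<And>\<sigma>. \<sigma> permutes {1..n} \<Longrightarrow> occurrences R' n (f \<sigma>) = occurrences R n \<sigma>"
  shows "s_count R' n k = s_count R n k"
proof -
  have "bij_betw f {\<sigma> \<in> {\<sigma>. \<sigma> permutes {1..n}}. occurrences R n \<sigma> = k}
     {\<sigma> \<in> {\<sigma>. \<sigma> permutes {1..n}}. occurrences R' n \<sigma> = k}"
    using assms unfolding bij_betw_def inj_on_def by (fastforce simp: image_iff set_eq_iff)
  then show ?thesis unfolding s_count_def using bij_betw_same_card by fastforce
qed

lemma F_biv_cong: "(\<And>n k. s_count R n k = s_count R' n k) \<Longrightarrow> F_biv R = F_biv R'"
  by (simp add: F_biv_def)

definition mesh_transpose :: "(nat \<times> nat) set \<Rightarrow> (nat \<times> nat) set" where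
  "mesh_transpose R = prod.swap ` R"

definition mesh_rotate :: "(nat \<times> nat) set \<Rightarrow> (nat \<times> nat) set" where
  "mesh_rotate R = (\<lambda>(x, y). (2 - x, 2 - y)) ` R"

text \<open>
  Passing to the inverse exchanges positions and values, that is, it reflects the plot of the permutation
  and the mesh in the diagonal; an occurrence \<open>(i1, i2)\<close> becomes \<open>(\<sigma> i1, \<sigma> i2)\<close>.
\<close>
lemma F_biv_mesh_transpose:
  shows "F_biv (mesh_transpose R) = F_biv R"
proof (rule F_biv_cong)
  fix n k :: nat
  have occ: "is_occurrence (mesh_transpose R) n (inv \<sigma>) (\<sigma> i1, \<sigma> i2) \<longleftrightarrow> is_occurrence R n \<sigma> (i1, i2)"
    if s: "\<sigma> permutes {1..n}" for \<sigma> i1 i2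
  proof -
    have inv: "inv \<sigma> (\<sigma> a) = a" for a using permutes_inverses(2)[OF s] .
    have ex: "(\<exists>l\<in>{1..n}. Q l) \<longleftrightarrow> (\<exists>l\<in>{1..n}. Q (\<sigma> l))" for Q
      by (subst permutes_image[OF s, symmetric]) (rule bex_simps)
    have rng: "\<sigma> l \<in> {1..n} \<longleftrightarrow> l \<in> {1..n}" for l using permutes_in_image[OF s] .
    let ?i = "(!) [0, i1, i2, n + 1]"
    let ?v = "(!) [0, \<sigma> i1, \<sigma> i2, n + 1]"
    have "(\<forall>(x, y)\<in>mesh_transpose R. \<not> (\<exists>l\<in>{1..n}. ?v x < l \<and> l < ?v (x + 1) \<and> ?i y < inv \<sigma> l \<and> inv \<sigma> l < ?i (y + 1))) \<longleftrightarrow>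
        (\<forall>(x, y)\<in>R. \<not> (\<exists>l\<in>{1..n}. ?v y < \<sigma> l \<and> \<sigma> l < ?v (y + 1) \<and> ?i x < l \<and> l < ?i (x + 1)))"
      unfolding mesh_transpose_def by (subst ex) (simp only: ball_simps inv case_prod_unfold fst_swap snd_swap)
    then show ?thesis unfolding is_occurrence_def Let_def prod.case inv
      by (simp only: rng conj_ac)
  qed
  show "s_count (mesh_transpose R) n k = s_count R n k"
  proof (rule s_count_bij[where f = inv])
    show "bij_betw inv {\<sigma>. \<sigma> permutes {1..n}} {\<sigma>. \<sigma> permutes {1..n}}"
      by (rule bij_betw_byWitness[where f' = inv]) (auto simp: permutes_inv permutes_inv_inv)
    fix \<sigma> assume s: "\<sigma> permutes {1..n}"
    have sur: "\<exists>a. \<sigma> a = b" for b using permutes_surj[OF s] by (metis surj_def)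
    have "bij_betw (\<lambda>(i1, i2). (\<sigma> i1, \<sigma> i2)) {p. is_occurrence R n \<sigma> p} {p. is_occurrence (mesh_transpose R) n (inv \<sigma>) p}"
    proof (rule bij_betw_imageI)
      show "inj_on (\<lambda>(i1, i2). (\<sigma> i1, \<sigma> i2)) {p. is_occurrence R n \<sigma> p}"
        using permutes_inj[OF s] by (auto simp: inj_on_def)
      show "(\<lambda>(i1, i2). (\<sigma> i1, \<sigma> i2)) ` {p. is_occurrence R n \<sigma> p} = {p. is_occurrence (mesh_transpose R) n (inv \<sigma>) p}"
      proof (intro equalityI subsetI)
        fix p assume p: "p \<in> {p. is_occurrence (mesh_transpose R) n (inv \<sigma>) p}"
        obtain a b where "p = (\<sigma> a, \<sigma> b)" using sur by (metis surj_pair)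
        then show "p \<in> (\<lambda>(i1, i2). (\<sigma> i1, \<sigma> i2)) ` {p. is_occurrence R n \<sigma> p}"
          using p occ[OF s] by (auto intro!: image_eqI[of _ _ "(a, b)"])
      qed (use occ[OF s] in auto)
    qed
    then show "occurrences (mesh_transpose R) n (inv \<sigma>) = occurrences R n \<sigma>"
      unfolding occurrences_def using bij_betw_same_card by fastforce
  qed
qed

text \<open>
  The reverse-complement rotates the plot of the permutation by a half-turn. This reverses the order of positions
  and of values, so 12 stays 12, its two points are exchanged, and cell \<open>(x, y)\<close> moves to
  \<open>(2 - x, 2 - y)\<close>.
\<close>
lemma F_biv_mesh_rotate:
  assumes R: "R \<subseteq> {0,1,2} \<times> {0,1,2}"
  shows "F_biv (mesh_rotate R) = F_biv R"
proof (rule F_biv_cong)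
  fix n k :: nat
  define c where "c = (\<lambda>x. if x \<in> {1..n} then n + 1 - x else x)"
  have cc: "c (c x) = x" for x by (auto simp: c_def)
  have cr: "c x \<in> {1..n} \<longleftrightarrow> x \<in> {1..n}" for x by (auto simp: c_def)
  have cp: "c permutes {1..n}"
    by (rule bij_imp_permutes) (auto simp: c_def intro!: bij_betw_byWitness[where f' = c])
  have less: "c a < c b \<longleftrightarrow> b < a" if "a \<in> {1..n}" "b \<in> {1..n}" for a b
    using that by (auto simp: c_def)
  have ex: "(\<exists>l\<in>{1..n}. Q l) \<longleftrightarrow> (\<exists>l\<in>{1..n}. Q (c l))" for Q
    by (subst permutes_image[OF cp, symmetric]) (rule bex_simps)
  have occ: "is_occurrence (mesh_rotate R) n (c \<circ> \<sigma> \<circ> c) (c i2, c i1) \<longleftrightarrow> is_occurrence R n \<sigma> (i1, i2)"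
    if s: "\<sigma> permutes {1..n}" for \<sigma> i1 i2
  proof (cases "i1 \<in> {1..n} \<and> i2 \<in> {1..n}")
    case False
    then show ?thesis unfolding is_occurrence_def prod.case cr by blast
  next
    case True
    have rng: "\<sigma> l \<in> {1..n} \<longleftrightarrow> l \<in> {1..n}" for l using permutes_in_image[OF s] .
    have cell: "([0, c b, c a, n + 1] ! (2 - x) < c l \<and> c l < [0, c b, c a, n + 1] ! (2 - x + 1)) \<longleftrightarrow>
        ([0, a, b, n + 1] ! x < l \<and> l < [0, a, b, n + 1] ! (x + 1))"
      if "x \<in> {0,1,2}" "a \<in> {1..n}" "b \<in> {1..n}" "l \<in> {1..n}" for a b x l
    proof -
      have "c l < n + 1" "0 < c l" "l < n + 1" "0 < l" using cr[of l] that(4) by auto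
      then show ?thesis using that less[of _ l] less[of l] by (auto simp: numeral_eq_Suc)
    qed
    let ?i = "(!) [0, i1, i2, n + 1]" and ?i' = "(!) [0, c i2, c i1, n + 1]"
    let ?v = "(!) [0, \<sigma> i1, \<sigma> i2, n + 1]" and ?v' = "(!) [0, c (\<sigma> i2), c (\<sigma> i1), n + 1]"
    have "(\<forall>(x, y)\<in>mesh_rotate R. \<not> (\<exists>l\<in>{1..n}. ?i' x < l \<and> l < ?i' (x + 1) \<and>
            ?v' y < c (\<sigma> (c l)) \<and> c (\<sigma> (c l)) < ?v' (y + 1))) \<longleftrightarrow>
       (\<forall>(x, y)\<in>R. \<not> (\<exists>l\<in>{1..n}. ?i' (2 - x) < c l \<and> c l < ?i' (2 - x + 1) \<and>
            ?v' (2 - y) < c (\<sigma> l) \<and> c (\<sigma> l) < ?v' (2 - y + 1)))"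
      unfolding mesh_rotate_def by (subst ex) (simp only: ball_simps cc case_prod_unfold fst_conv snd_conv)
    also have "\<dots> \<longleftrightarrow> (\<forall>(x, y)\<in>R. \<not> (\<exists>l\<in>{1..n}. ?i x < l \<and> l < ?i (x + 1) \<and> ?v y < \<sigma> l \<and> \<sigma> l < ?v (y + 1)))"
    proof (rule ball_cong[OF refl], clarify)
      fix x y assume "(x, y) \<in> R"
      then have xy: "x \<in> {0,1,2}" "y \<in> {0,1,2}" using R by auto
      have "(?i' (2 - x) < c l \<and> c l < ?i' (2 - x + 1) \<and> ?v' (2 - y) < c (\<sigma> l) \<and> c (\<sigma> l) < ?v' (2 - y + 1)) \<longleftrightarrow>
            (?i x < l \<and> l < ?i (x + 1) \<and> ?v y < \<sigma> l \<and> \<sigma> l < ?v (y + 1))" if l: "l \<in> {1..n}" for l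
        using cell[OF xy(1), of i1 i2 l] cell[OF xy(2), of "\<sigma> i1" "\<sigma> i2" "\<sigma> l"] True l
        unfolding rng by blast
      then show "(\<not> (\<exists>l\<in>{1..n}. ?i' (2 - x) < c l \<and> c l < ?i' (2 - x + 1) \<and> ?v' (2 - y) < c (\<sigma> l) \<and> c (\<sigma> l) < ?v' (2 - y + 1))) \<longleftrightarrow>
          (\<not> (\<exists>l\<in>{1..n}. ?i x < l \<and> l < ?i (x + 1) \<and> ?v y < \<sigma> l \<and> \<sigma> l < ?v (y + 1)))"
        by (intro arg_cong[of _ _ Not] bex_cong refl)
    qed
    finally have mesh: "(\<forall>(x, y)\<in>mesh_rotate R. \<not> (\<exists>l\<in>{1..n}. ?i' x < l \<and> l < ?i' (x + 1) \<and>
            ?v' y < c (\<sigma> (c l)) \<and> c (\<sigma> (c l)) < ?v' (y + 1))) \<longleftrightarrow>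
       (\<forall>(x, y)\<in>R. \<not> (\<exists>l\<in>{1..n}. ?i x < l \<and> l < ?i (x + 1) \<and> ?v y < \<sigma> l \<and> \<sigma> l < ?v (y + 1)))" .
    have lt: "c i2 < c i1 \<longleftrightarrow> i1 < i2" "c (\<sigma> i2) < c (\<sigma> i1) \<longleftrightarrow> \<sigma> i1 < \<sigma> i2"
      using True by (simp_all only: less rng)
    show ?thesis unfolding is_occurrence_def Let_def prod.case o_apply cc cr lt mesh
      by (simp only: conj_ac)
  qed
  show "s_count (mesh_rotate R) n k = s_count R n k"
  proof (rule s_count_bij[where f = "\<lambda>\<sigma>. c \<circ> \<sigma> \<circ> c"])
    have "c \<circ> \<sigma> \<circ> c permutes {1..n}" if "\<sigma> permutes {1..n}" for \<sigma>
      by (rule permutes_compose[OF cp permutes_compose[OF that cp]])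
    moreover have "c \<circ> (c \<circ> \<sigma> \<circ> c) \<circ> c = \<sigma>" for \<sigma>
      by (simp add: fun_eq_iff cc)
    ultimately show "bij_betw (\<lambda>\<sigma>. c \<circ> \<sigma> \<circ> c) {\<sigma>. \<sigma> permutes {1..n}} {\<sigma>. \<sigma> permutes {1..n}}"
      by (intro bij_betw_byWitness[where f' = "\<lambda>\<sigma>. c \<circ> \<sigma> \<circ> c"]) blast+
    fix \<sigma> assume s: "\<sigma> permutes {1..n}"
    have "bij_betw (\<lambda>(i1, i2). (c i2, c i1)) {p. is_occurrence R n \<sigma> p} {p. is_occurrence (mesh_rotate R) n (c \<circ> \<sigma> \<circ> c) p}"
    proof (rule bij_betw_byWitness[where f' = "\<lambda>(i1, i2). (c i2, c i1)"])
      show "(\<lambda>(i1, i2). (c i2, c i1)) ` {p. is_occurrence R n \<sigma> p} \<subseteq> {p. is_occurrence (mesh_rotate R) n (c \<circ> \<sigma> \<circ> c) p}"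
        using occ[OF s] by auto
      show "(\<lambda>(i1, i2). (c i2, c i1)) ` {p. is_occurrence (mesh_rotate R) n (c \<circ> \<sigma> \<circ> c) p} \<subseteq> {p. is_occurrence R n \<sigma> p}"
      proof clarify
        fix a b assume "is_occurrence (mesh_rotate R) n (c \<circ> \<sigma> \<circ> c) (a, b)"
        then show "is_occurrence R n \<sigma> (c b, c a)" using occ[OF s, of "c a" "c b"] by (simp add: cc)
      qed
    qed (auto simp: cc)
    then show "occurrences (mesh_rotate R) n (c \<circ> \<sigma> \<circ> c) = occurrences R n \<sigma>"
      unfolding occurrences_def using bij_betw_same_card by fastforce
  qed
qed

text \<open>
  In the order of the list, the first four sets are the orbit of \<open>canonical_mesh 2\<close> and the last four
  that of \<open>canonical_mesh 0\<close>.
\<close>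
lemma F_biv_eight_patterns:
  assumes "R \<in> {
    {(0,2),(2,2),(1,1),(2,1),(0,0)},
    {(0,2),(2,2),(1,1),(0,0),(1,0)},
    {(1,2),(2,2),(1,1),(0,0),(2,0)},
    {(2,2),(0,1),(1,1),(0,0),(2,0)},
    {(0,2),(2,2),(0,1),(1,1),(2,0)},
    {(0,2),(1,2),(1,1),(0,0),(2,0)},
    {(0,2),(1,1),(2,1),(0,0),(2,0)},
    {(0,2),(2,2),(1,1),(1,0),(2,0)}}"
  shows "\<exists>y. (y = 0 \<or> y = 2) \<and> F_biv R = F_biv (canonical_mesh y)"
proof -
  have sub: "canonical_mesh y \<subseteq> {0,1,2} \<times> {0,1,2}" "mesh_transpose (canonical_mesh y) \<subseteq> {0,1,2} \<times> {0,1,2}"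
    if "y = 0 \<or> y = 2" for y
    using that by (auto simp: canonical_mesh_def mesh_transpose_def)
  have "\<exists>y. (y = 0 \<or> y = 2) \<and> R \<in> {canonical_mesh y, mesh_transpose (canonical_mesh y),
     mesh_rotate (canonical_mesh y), mesh_rotate (mesh_transpose (canonical_mesh y))}"
    unfolding canonical_mesh_def mesh_transpose_def mesh_rotate_def image_insert image_empty
      prod.swap_def prod.case fst_conv snd_conv
    using assms unfolding insert_iff empty_iff
    by (elim disjE) (simp_all add: insert_commute ex_disj_distrib conj_disj_distribR)
  then show ?thesis using F_biv_mesh_transpose F_biv_mesh_rotate sub by auto
qed

section \<open>The explicit coefficients\<close>

lemma sum_triangle:
  fixes f :: "nat \<Rightarrow> nat \<Rightarrow> 'a::comm_monoid_add"
  shows "(\<Sum>h\<le>s. \<Sum>k<h. f h k) = (\<Sum>k<s. \<Sum>j\<le>s - 1 - k. f (k + j + 1) k)"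
proof -
  have "(\<Sum>(h, k)\<in>Sigma {..s} (\<lambda>h. {..<h}). f h k) = (\<Sum>(k, j)\<in>Sigma {..<s} (\<lambda>k. {..s - 1 - k}). f (k + j + 1) k)"
    by (rule sum.reindex_bij_witness[where j = "\<lambda>(h, k). (k, h - 1 - k)" and i = "\<lambda>(k, j). (k + j + 1, k)"]) auto
  then show ?thesis by (simp add: sum.Sigma)
qed

text \<open>
  Convolution of the coefficients of \<open>(1 - x) ^ - (p + 1)\<close> and \<open>(1 - x) ^ - (r + 1)\<close>.
\<close>
lemma sum_choose_mult_choose:
  "(\<Sum>a\<le>n. ((p + a) choose p) * ((r + (n - a)) choose r)) = (p + r + 1 + n) choose n"
proof (induction r arbitrary: n)
  case 0
  show ?case using choose_rising_sum(2)[of p n] by simp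
next
  case (Suc r)
  show ?case
  proof (induction n)
    case 0
    show ?case by simp
  next
    case (Suc n)
    have "(\<Sum>a\<le>Suc n. ((p + a) choose p) * ((Suc r + (Suc n - a)) choose Suc r)) =
        (\<Sum>a\<le>n. ((p + a) choose p) * ((Suc r + (Suc n - a)) choose Suc r)) + ((p + Suc n) choose p)"
      by simp
    also have "(\<Sum>a\<le>n. ((p + a) choose p) * ((Suc r + (Suc n - a)) choose Suc r)) =
        (\<Sum>a\<le>n. ((p + a) choose p) * ((r + (Suc n - a)) choose r) +
           ((p + a) choose p) * ((Suc r + (n - a)) choose Suc r))"
      by (intro sum.cong refl) (simp add: Suc_diff_le algebra_simps)
    also have "\<dots> + ((p + Suc n) choose p) = (\<Sum>a\<le>Suc n. ((p + a) choose p) * ((r + (Suc n - a)) choose r)) +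
        (\<Sum>a\<le>n. ((p + a) choose p) * ((Suc r + (n - a)) choose Suc r))"
      by (simp add: sum.distrib)
    also have "\<dots> = (p + Suc r + 1 + Suc n) choose Suc n"
      unfolding Suc.IH \<open>\<And>n. (\<Sum>a\<le>n. ((p + a) choose p) * ((r + (n - a)) choose r)) = (p + r + 1 + n) choose n\<close>
      by simp
    finally show ?case .
  qed
qed

definition S_ser :: "int fps" where
  "S_ser = Abs_fps S_coeff"

lemma S_ser_mult: "S_ser * (1 + fps_X * F_ser) = F_ser"
proof -
  have eq: "S_ser = quot_ser F_ser (1 + fps_X * F_ser)"
    by (rule fps_ext) (simp add: S_ser_def S_coeff_def)
  show ?thesis unfolding eq by (rule quot_ser_mult) simp
qed

lemma fps_X_mult_mult_nth:
  fixes f g :: "'a::comm_ring_1 fps"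
  shows "(fps_X * (f * g)) $ s = (\<Sum>k<s. f $ k * g $ (s - 1 - k))"
  unfolding fps_X_mult_nth fps_mult_nth[of f g]
  by (cases s) (simp_all add: atLeast0AtMost lessThan_Suc_atMost)

text \<open>
  Coefficients of \<open>F = S + t S F\<close>.
\<close>
lemma fact_eq_S_coeff:
  "int (fact h) = S_coeff h + (\<Sum>k<h. S_coeff k * int (fact (h - 1 - k)))"
proof -
  have "F_ser $ h = (S_ser + fps_X * (S_ser * F_ser)) $ h"
    using arg_cong[OF S_ser_mult, of "\<lambda>f. f $ h"] by (simp only: algebra_simps mult_1_right mult_1_left)
  then show ?thesis unfolding fps_add_nth fps_X_mult_mult_nth by (simp add: F_ser_def S_ser_def)
qed

text \<open>
  The number of remainders with \<open>s\<close> values besides \<open>b\<close>, over all ways to distribute them below and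
  above the block.
\<close>
definition remainder_count :: "nat \<Rightarrow> nat" where
  "remainder_count s = (\<Sum>h\<le>s. fact (s + 1) div (h + 1))"

lemma fact_div_Suc:
  "fact (h + u + 1) div (h + 1) = fact h * fact u * ((h + u + 1) choose u :: nat)"
proof -
  have "fact u * fact (h + 1) * ((h + u + 1) choose u) = fact (h + u + 1)"
    using binomial_fact_lemma[of u "h + u + 1"] by simp
  then have "fact (h + u + 1) = (h + 1) * (fact h * fact u * ((h + u + 1) choose u) :: nat)"
    by (simp add: algebra_simps)
  then show ?thesis by (metis nonzero_mult_div_cancel_left Suc_eq_plus1 nat.simps(3))
qed

lemma remainder_count_eq:
  "remainder_count s = (\<Sum>h\<le>s. fact h * fact (s - h) * ((s + 1) choose (s - h)))"
  unfolding remainder_count_def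
proof (rule sum.cong[OF refl])
  fix h assume "h \<in> {..s}"
  then show "fact (s + 1) div (h + 1) = fact h * fact (s - h) * ((s + 1) choose (s - h))"
    using fact_div_Suc[of h "s - h"] by simp
qed

definition remainder_count_ser :: "int fps" where
  "remainder_count_ser = Abs_fps (\<lambda>s. int (remainder_count s))"

text \<open>
  This is the series \<open>N / (1 + t F)\<close>, where \<open>N\<close> counts remainders. It counts the remainders of
  last occurrences, those that no block extends.
\<close>
definition terminal_ser :: "int fps" where
  "terminal_ser = remainder_count_ser * (1 - fps_X * S_ser)"

lemma terminal_ser_mult: "terminal_ser * (1 + fps_X * F_ser) = remainder_count_ser"
proof -
  have "(1 - fps_X * S_ser) * (1 + fps_X * F_ser) = 1 + fps_X * F_ser - fps_X * (S_ser * (1 + fps_X * F_ser))"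
    by (simp add: algebra_simps)
  also have "\<dots> = 1" by (simp add: S_ser_mult)
  finally show ?thesis by (simp add: terminal_ser_def mult.assoc)
qed

text \<open>
  By the hockey-stick identity for \<open>j1\<close>, the double sum is a binomial convolution without its first
  term, which is the second summand on the left.
\<close>
lemma inner_binomial_sum:
  "(\<Sum>j2\<le>w. \<Sum>j1\<le>w - j2. ((k2 + j2 + 1) choose k2) * ((k1 + j1) choose k1)) + ((k1 + w + 2) choose (w + 1))
    = (k1 + k2 + w + 3) choose (w + 1)"
proof -
  have shift: "(\<Sum>j2\<le>w. \<Sum>j1\<le>w - j2. ((k2 + j2 + 1) choose k2) * ((k1 + j1) choose k1)) =
      (\<Sum>j2\<le>w. ((k2 + Suc j2) choose k2) * ((k1 + 1 + (w + 1 - Suc j2)) choose (k1 + 1)))"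
    unfolding sum_distrib_left[symmetric] choose_rising_sum(1) by (intro sum.cong refl) simp
  have "(\<Sum>j2\<le>w. ((k2 + Suc j2) choose k2) * ((k1 + 1 + (w + 1 - Suc j2)) choose (k1 + 1))) + ((k1 + w + 2) choose (w + 1)) =
      (\<Sum>a\<le>w + 1. ((k2 + a) choose k2) * ((k1 + 1 + (w + 1 - a)) choose (k1 + 1)))"
    using binomial_symmetric[of "w + 1" "k1 + w + 2"] by (simp add: sum.atMost_Suc_shift del: sum.atMost_Suc)
  also have "\<dots> = (k1 + k2 + w + 3) choose (w + 1)"
    unfolding sum_choose_mult_choose by (simp add: algebra_simps numeral_eq_Suc)
  finally show ?thesis unfolding shift .
qed

lemma sum_triples:
  fixes f :: "nat \<Rightarrow> nat \<Rightarrow> nat \<Rightarrow> 'a::comm_monoid_add"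
  shows "(\<Sum>(i, j, k) \<in> {(i, j, k). i + j + k = s}. f i j k) = (\<Sum>k\<le>s. \<Sum>j\<le>s - k. f (s - k - j) j k)"
proof -
  have "(\<Sum>k\<le>s. \<Sum>j\<le>s - k. f (s - k - j) j k) = (\<Sum>(k, j)\<in>Sigma {..s} (\<lambda>k. {..s - k}). f (s - k - j) j k)"
    by (simp add: sum.Sigma)
  also have "\<dots> = (\<Sum>(i, j, k) \<in> {(i, j, k). i + j + k = s}. f i j k)"
    by (rule sum.reindex_bij_witness[where i = "\<lambda>(i, j, k). (k, j)" and j = "\<lambda>(k, j). (s - k - j, j, k)"]) auto
  finally show ?thesis by simp
qed

lemma sum_quintuples:
  fixes f :: "nat \<Rightarrow> nat \<Rightarrow> nat \<Rightarrow> nat \<Rightarrow> nat \<Rightarrow> 'a::comm_monoid_add"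
  shows "(\<Sum>(i, j1, j2, k1, k2) \<in> {(i, j1, j2, k1, k2). i + j1 + j2 + k1 + k2 + 2 = s}. f i j1 j2 k1 k2) =
    (\<Sum>k2<s. \<Sum>k1<s - 1 - k2. \<Sum>j2\<le>s - 2 - k2 - k1. \<Sum>j1\<le>s - 2 - k2 - k1 - j2. f (s - 2 - k2 - k1 - j2 - j1) j1 j2 k1 k2)"
proof -
  let ?I = "Sigma {..<s} (\<lambda>k2. Sigma {..<s - 1 - k2} (\<lambda>k1. Sigma {..s - 2 - k2 - k1} (\<lambda>j2. {..s - 2 - k2 - k1 - j2})))"
  have "(\<Sum>k2<s. \<Sum>k1<s - 1 - k2. \<Sum>j2\<le>s - 2 - k2 - k1. \<Sum>j1\<le>s - 2 - k2 - k1 - j2. f (s - 2 - k2 - k1 - j2 - j1) j1 j2 k1 k2)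
     = (\<Sum>(k2, k1, j2, j1)\<in>?I. f (s - 2 - k2 - k1 - j2 - j1) j1 j2 k1 k2)"
    by (simp add: sum.Sigma)
  also have "\<dots> = (\<Sum>(i, j1, j2, k1, k2) \<in> {(i, j1, j2, k1, k2). i + j1 + j2 + k1 + k2 + 2 = s}. f i j1 j2 k1 k2)"
    by (rule sum.reindex_bij_witness[where i = "\<lambda>(i, j1, j2, k1, k2). (k2, k1, j2, j1)"
          and j = "\<lambda>(k2, k1, j2, j1). (s - 2 - k2 - k1 - j2 - j1, j1, j2, k1, k2)"]) auto
  finally show ?thesis by simp
qed

text \<open>
  In \<open>C = N - t S N\<close> the factor \<open>h!\<close> in \<open>N\<close> is replaced by
  \<open>S\<^sub>h + (\<Sum>k<h. S\<^sub>k (h - 1 - k)!)\<close>. The terms with \<open>S\<^sub>h\<close> are the first sum. The others, less those of \<open>t S N\<close>,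
  form the second sum with \<open>k2 = k\<close> and \<open>k1 = h - 1 - k\<close>: their difference of binomial coefficients is
  the inner sum over \<open>i\<close>, \<open>j1\<close>, \<open>j2\<close>.
\<close>
lemma terminal_ser_nth:
  "terminal_ser $ s =
    (\<Sum>(i, j, k) \<in> {(i, j, k). i + j + k = s}. int ((j + k) choose k) * int (fact (i + j)) * S_coeff k) +
    (\<Sum>(i, j1, j2, k1, k2) \<in> {(i, j1, j2, k1, k2). i + j1 + j2 + k1 + k2 + 2 = s}.
       int ((k2 + j2 + 1) choose k2) * int ((k1 + j1) choose k1) * int (fact k1) *
       int (fact (i + j1 + j2 + 1)) * S_coeff k2)" (is "_ = ?A + ?B")
proof -
  have A: "?A = (\<Sum>h\<le>s. int (fact (s - h) * ((s + 1) choose (s - h))) * S_coeff h)"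
    unfolding sum_triples
  proof (rule sum.cong[OF refl])
    fix k assume k: "k \<in> {..s}"
    have "(\<Sum>j\<le>s - k. int ((j + k) choose k) * int (fact (s - k - j + j)) * S_coeff k) =
        (\<Sum>j\<le>s - k. int ((k + j) choose k) * (int (fact (s - k)) * S_coeff k))"
      by (intro sum.cong refl) (simp only: atMost_iff le_add_diff_inverse2, simp add: add.commute mult.assoc)
    also have "\<dots> = int (\<Sum>j\<le>s - k. (k + j) choose k) * (int (fact (s - k)) * S_coeff k)"
      by (simp add: sum_distrib_right)
    also have "\<dots> = int (fact (s - k) * ((s + 1) choose (s - k))) * S_coeff k"
      using k unfolding choose_rising_sum(2) by simp
    finally show "(\<Sum>j\<le>s - k. int ((j + k) choose k) * int (fact (s - k - j + j)) * S_coeff k) =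
        int (fact (s - k) * ((s + 1) choose (s - k))) * S_coeff k" .
  qed
  let ?t = "\<lambda>k2 k1. int (fact k1 * fact (s - 1 - k2 - k1)) * S_coeff k2 *
      (int ((s + 1) choose (s - 1 - k2 - k1)) - int ((s - k2) choose (s - 1 - k2 - k1)))"
  have "?B = (\<Sum>k2<s. \<Sum>k1<s - 1 - k2. ?t k2 k1)"
    unfolding sum_quintuples
  proof (intro sum.cong refl)
    fix k2 k1 assume k: "k2 \<in> {..<s}" "k1 \<in> {..<s - 1 - k2}"
    define w where "w = s - 2 - k2 - k1"
    have s: "s = k1 + k2 + w + 2" using k by (auto simp: w_def)
    have "(\<Sum>j2\<le>w. \<Sum>j1\<le>w - j2. int ((k2 + j2 + 1) choose k2) * int ((k1 + j1) choose k1) * int (fact k1) *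
          int (fact (w - j2 - j1 + j1 + j2 + 1)) * S_coeff k2) =
        (\<Sum>j2\<le>w. \<Sum>j1\<le>w - j2. int (((k2 + j2 + 1) choose k2) * ((k1 + j1) choose k1)) *
          (int (fact k1 * fact (w + 1)) * S_coeff k2))"
      by (intro sum.cong refl) (auto simp: algebra_simps)
    also have "\<dots> = int (\<Sum>j2\<le>w. \<Sum>j1\<le>w - j2. ((k2 + j2 + 1) choose k2) * ((k1 + j1) choose k1)) *
          (int (fact k1 * fact (w + 1)) * S_coeff k2)"
      by (simp only: sum_distrib_right of_nat_sum)
    also have "int (\<Sum>j2\<le>w. \<Sum>j1\<le>w - j2. ((k2 + j2 + 1) choose k2) * ((k1 + j1) choose k1)) =
        int ((k1 + k2 + w + 3) choose (w + 1)) - int ((k1 + w + 2) choose (w + 1))"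
      unfolding inner_binomial_sum[of k2 k1 w, symmetric] by simp
    finally show "(\<Sum>j2\<le>s - 2 - k2 - k1. \<Sum>j1\<le>s - 2 - k2 - k1 - j2. int ((k2 + j2 + 1) choose k2) * int ((k1 + j1) choose k1) * int (fact k1) *
          int (fact (s - 2 - k2 - k1 - j2 - j1 + j1 + j2 + 1)) * S_coeff k2) = ?t k2 k1"
      unfolding w_def[symmetric] using s by (simp add: algebra_simps numeral_eq_Suc)
  qed
  \<comment> \<open>The added terms \<open>k1 = s - 1 - k2\<close> vanish: both binomial coefficients are 1.\<close>
  also have "\<dots> = (\<Sum>k2<s. \<Sum>k1\<le>s - 1 - k2. ?t k2 k1)"
  proof (rule sum.cong[OF refl])
    fix k2
    have "?t k2 (s - 1 - k2) = 0" by simp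
    then show "(\<Sum>k1<s - 1 - k2. ?t k2 k1) = (\<Sum>k1\<le>s - 1 - k2. ?t k2 k1)"
      by (simp only: lessThan_Suc_atMost[symmetric] sum.lessThan_Suc add_0_right)
  qed
  also have "\<dots> = (\<Sum>k2<s. \<Sum>k1\<le>s - 1 - k2. int (fact (s - (k2 + k1 + 1)) * ((s + 1) choose (s - (k2 + k1 + 1)))) *
        (S_coeff k2 * int (fact (k2 + k1 + 1 - 1 - k2)))) -
      (\<Sum>k2<s. S_coeff k2 * int (\<Sum>k1\<le>s - 1 - k2. fact k1 * fact (s - 1 - k2 - k1) * ((s - 1 - k2 + 1) choose (s - 1 - k2 - k1))))"
    unfolding sum_subtractf[symmetric] of_nat_sum sum_distrib_left
    by (intro sum.cong refl) (auto simp: algebra_simps Suc_diff_Suc)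
  also have "(\<Sum>k2<s. \<Sum>k1\<le>s - 1 - k2. int (fact (s - (k2 + k1 + 1)) * ((s + 1) choose (s - (k2 + k1 + 1)))) *
        (S_coeff k2 * int (fact (k2 + k1 + 1 - 1 - k2)))) =
      (\<Sum>h\<le>s. int (fact (s - h) * ((s + 1) choose (s - h))) * (\<Sum>k<h. S_coeff k * int (fact (h - 1 - k))))"
    unfolding sum_distrib_left by (rule sum_triangle[symmetric])
  also have "(\<Sum>k2<s. S_coeff k2 * int (\<Sum>k1\<le>s - 1 - k2. fact k1 * fact (s - 1 - k2 - k1) * ((s - 1 - k2 + 1) choose (s - 1 - k2 - k1))))
      = (fps_X * (S_ser * remainder_count_ser)) $ s"
    unfolding fps_X_mult_mult_nth remainder_count_eq[symmetric] by (simp add: S_ser_def remainder_count_ser_def)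
  finally have B: "?B = (\<Sum>h\<le>s. int (fact (s - h) * ((s + 1) choose (s - h))) * (\<Sum>k<h. S_coeff k * int (fact (h - 1 - k)))) -
      (fps_X * (S_ser * remainder_count_ser)) $ s" .
  have "?A + ?B = (\<Sum>h\<le>s. int (fact (s - h) * ((s + 1) choose (s - h))) *
      (S_coeff h + (\<Sum>k<h. S_coeff k * int (fact (h - 1 - k))))) - (fps_X * (S_ser * remainder_count_ser)) $ s"
    unfolding A B by (simp only: sum.distrib distrib_left add_diff_eq)
  also have "(\<Sum>h\<le>s. int (fact (s - h) * ((s + 1) choose (s - h))) *
      (S_coeff h + (\<Sum>k<h. S_coeff k * int (fact (h - 1 - k))))) =
      (\<Sum>h\<le>s. int (fact (s - h) * ((s + 1) choose (s - h))) * int (fact h))"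
    by (simp only: fact_eq_S_coeff[symmetric])
  also have "(\<Sum>h\<le>s. int (fact (s - h) * ((s + 1) choose (s - h))) * int (fact h)) = remainder_count_ser $ s"
    by (simp add: remainder_count_ser_def remainder_count_eq algebra_simps)
  also have "remainder_count_ser $ s - (fps_X * (S_ser * remainder_count_ser)) $ s = terminal_ser $ s"
    by (simp add: terminal_ser_def algebra_simps)
  finally show ?thesis by simp
qed

lemma lift_q_add: "lift_q (f + g) = lift_q f + lift_q g"
  by (rule fps_ext) (simp add: lift_q_def)

lemma lift_q_mult: "lift_q (f * g) = lift_q f * lift_q g"
proof (rule fps_ext)
  fix n
  have h: "[:\<Sum>i\<in>A. c i:] = (\<Sum>i\<in>A. [:c i:])" for c :: "nat \<Rightarrow> int" and A
    by (rule poly_eqI) (simp add: coeff_sum coeff_pCons split: nat.split)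
  show "lift_q (f * g) $ n = (lift_q f * lift_q g) $ n"
    by (simp add: lift_q_def fps_mult_nth h mult.commute)
qed

lemma lift_q_1: "lift_q 1 = 1"
  by (rule fps_ext) (simp add: lift_q_def one_pCons)

lemma lift_q_fps_X: "lift_q fps_X = fps_X"
  by (rule fps_ext) (simp add: lift_q_def fps_X_def one_pCons)

lemma lift_q_F_ser: "lift_q F_ser = F_ser"
  by (rule fps_ext) (simp add: lift_q_def F_ser_def of_nat_poly)

lemma lift_q_minus: "lift_q (f - g) = lift_q f - lift_q g"
  by (rule fps_ext) (simp add: lift_q_def)

definition T_ser :: "int poly fps" where
  "T_ser = Abs_fps T_coeff"

lemma T_ser_mult: "T_ser * (1 + fps_X * fps_const (1 - [:0, 1:]) * F_ser) = F_ser"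
proof -
  have eq: "T_ser = quot_ser F_ser (1 + fps_X * fps_const (1 - [:0, 1:]) * F_ser)"
    by (rule fps_ext) (simp add: T_ser_def T_coeff_def)
  show ?thesis unfolding eq by (rule quot_ser_mult) simp
qed

lemma formula_eq_terminal_ser:
  "Abs_fps (\<lambda>n. [:0, 1:] * (
      (\<Sum>(i, j, k, m) \<in> {(i, j, k, m). i + j + k + m + 2 = n}.
         of_nat ((j + k) choose k) * of_nat (fact (i + j)) * T_coeff m * of_int (S_coeff k)) +
      (\<Sum>(i, j1, j2, k1, k2, m) \<in> {(i, j1, j2, k1, k2, m). i + j1 + j2 + k1 + k2 + m + 4 = n}.
         of_nat ((k2 + j2 + 1) choose k2) * of_nat ((k1 + j1) choose k1) * of_nat (fact k1) *
         of_nat (fact (i + j1 + j2 + 1)) * T_coeff m * of_int (S_coeff k2))))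
   = fps_const [:0, 1:] * (fps_X ^ 2 * (T_ser * lift_q terminal_ser))" (is "?L = _")
proof (rule fps_ext)
  fix n :: nat
  let ?a = "\<lambda>i j k. int ((j + k) choose k) * int (fact (i + j)) * S_coeff k"
  let ?b = "\<lambda>i j1 j2 k1 k2. int ((k2 + j2 + 1) choose k2) * int ((k1 + j1) choose k1) * int (fact k1) *
       int (fact (i + j1 + j2 + 1)) * S_coeff k2"
  let ?A = "\<lambda>s. {(i, j, k). i + j + k = (s::nat)}"
  let ?B = "\<lambda>s. {(i, j1, j2, k1, k2). i + j1 + j2 + k1 + k2 + 2 = (s::nat)}"
  have fA: "finite (?A s)" for s by (rule finite_subset[of _ "{..s} \<times> {..s} \<times> {..s}"]) auto
  have fB: "finite (?B s)" for s by (rule finite_subset[of _ "{..s} \<times> {..s} \<times> {..s} \<times> {..s} \<times> {..s}"]) auto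
  let ?M = "{m. m + 2 \<le> n}"
  have fM: "finite ?M" by (rule finite_subset[of _ "{..n}"]) auto
  have "(\<Sum>(i, j, k, m) \<in> {(i, j, k, m). i + j + k + m + 2 = n}.
         of_nat ((j + k) choose k) * of_nat (fact (i + j)) * T_coeff m * of_int (S_coeff k)) =
      (\<Sum>(m, i, j, k)\<in>Sigma ?M (\<lambda>m. ?A (n - 2 - m)). T_coeff m * of_int (?a i j k))"
    by (rule sum.reindex_bij_witness[where j = "\<lambda>(i, j, k, m). (m, i, j, k)" and i = "\<lambda>(m, i, j, k). (i, j, k, m)"])
      (auto simp: mult_ac)
  also have "\<dots> = (\<Sum>m\<in>?M. \<Sum>(i, j, k)\<in>?A (n - 2 - m). T_coeff m * of_int (?a i j k))"
    using fM fA by (subst sum.Sigma) (auto simp: case_prod_unfold)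
  finally have 1: "(\<Sum>(i, j, k, m) \<in> {(i, j, k, m). i + j + k + m + 2 = n}.
         of_nat ((j + k) choose k) * of_nat (fact (i + j)) * T_coeff m * of_int (S_coeff k)) =
     (\<Sum>m\<in>?M. T_coeff m * of_int (\<Sum>(i, j, k)\<in>?A (n - 2 - m). ?a i j k))"
    by (simp only: sum_distrib_left of_int_sum case_prod_unfold)
  have "(\<Sum>(i, j1, j2, k1, k2, m) \<in> {(i, j1, j2, k1, k2, m). i + j1 + j2 + k1 + k2 + m + 4 = n}.
         of_nat ((k2 + j2 + 1) choose k2) * of_nat ((k1 + j1) choose k1) * of_nat (fact k1) *
         of_nat (fact (i + j1 + j2 + 1)) * T_coeff m * of_int (S_coeff k2)) =
      (\<Sum>(m, i, j1, j2, k1, k2)\<in>Sigma ?M (\<lambda>m. ?B (n - 2 - m)). T_coeff m * of_int (?b i j1 j2 k1 k2))"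
    by (rule sum.reindex_bij_witness[where j = "\<lambda>(i, j1, j2, k1, k2, m). (m, i, j1, j2, k1, k2)"
          and i = "\<lambda>(m, i, j1, j2, k1, k2). (i, j1, j2, k1, k2, m)"])
      (auto simp: mult_ac)
  also have "\<dots> = (\<Sum>m\<in>?M. \<Sum>(i, j1, j2, k1, k2)\<in>?B (n - 2 - m). T_coeff m * of_int (?b i j1 j2 k1 k2))"
    using fM fB by (subst sum.Sigma) (auto simp: case_prod_unfold)
  finally have 2: "(\<Sum>(i, j1, j2, k1, k2, m) \<in> {(i, j1, j2, k1, k2, m). i + j1 + j2 + k1 + k2 + m + 4 = n}.
         of_nat ((k2 + j2 + 1) choose k2) * of_nat ((k1 + j1) choose k1) * of_nat (fact k1) *
         of_nat (fact (i + j1 + j2 + 1)) * T_coeff m * of_int (S_coeff k2)) =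
     (\<Sum>m\<in>?M. T_coeff m * of_int (\<Sum>(i, j1, j2, k1, k2)\<in>?B (n - 2 - m). ?b i j1 j2 k1 k2))"
    by (simp only: sum_distrib_left of_int_sum case_prod_unfold)
  have "?L $ n = [:0, 1:] * (\<Sum>m\<in>?M. T_coeff m * of_int (terminal_ser $ (n - 2 - m)))"
    unfolding fps_nth_Abs_fps 1 2 terminal_ser_nth of_int_add distrib_left sum.distrib ..
  also have "(\<Sum>m\<in>?M. T_coeff m * of_int (terminal_ser $ (n - 2 - m))) = (fps_X ^ 2 * (T_ser * lift_q terminal_ser)) $ n"
  proof (cases "n < 2")
    case True
    then have "?M = {}" by auto
    then show ?thesis using True by (simp only: fps_X_power_mult_nth sum.empty if_True)
  next
    case False
    then have "?M = {0..n - 2}" by auto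
    then show ?thesis using False unfolding fps_X_power_mult_nth fps_mult_nth[of T_ser]
      by (simp add: T_ser_def lift_q_def of_int_poly)
  qed
  finally show "?L $ n = (fps_const [:0, 1:] * (fps_X ^ 2 * (T_ser * lift_q terminal_ser))) $ n"
    by (simp only: fps_mult_left_const_nth)
qed

section \<open>The generating function\<close>

text \<open>
  The counts for the two relations are exchanged by \<open>h \<mapsto> s - h\<close>, so their sums
  agree. This is why both symmetry classes have the same distribution.
\<close>
lemma sum_card_remainders:
  assumes r: "r = (<) \<or> r = (>)"
  shows "(\<Sum>h\<le>s. card (remainders r (h + 1) h (s - h))) = remainder_count s"
proof (cases "r = (<)")
  case True
  have "card (remainders r (h + 1) h (s - h)) = fact (s + 1) div (s - h + 1)" if "h \<le> s" for h
  proof -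
    have "(s - h + 1) * card (remainders r (h + 1) h (s - h)) = fact (s + 1)"
      using card_remainders[of h "h + 1" r "s - h"] r True that by simp
    then show ?thesis by (metis nonzero_mult_div_cancel_left Suc_eq_plus1 nat.simps(3))
  qed
  then have "(\<Sum>h\<le>s. card (remainders r (h + 1) h (s - h))) = (\<Sum>h\<le>s. fact (s + 1) div (s - h + 1))"
    by (intro sum.cong) auto
  also have "\<dots> = (\<Sum>h\<le>s. fact (s + 1) div (h + 1))"
    by (rule sum.reindex_bij_witness[where i = "\<lambda>h. s - h" and j = "\<lambda>h. s - h"]) auto
  finally show ?thesis by (simp only: remainder_count_def)
next
  case False
  have "card (remainders r (h + 1) h (s - h)) = fact (s + 1) div (h + 1)" if "h \<le> s" for h
  proof -
    have "(h + 1) * card (remainders r (h + 1) h (s - h)) = fact (s + 1)"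
      using card_remainders[of h "h + 1" r "s - h"] r False that by simp
    then show ?thesis by (metis nonzero_mult_div_cancel_left Suc_eq_plus1 nat.simps(3))
  qed
  then show ?thesis unfolding remainder_count_def by (intro sum.cong) auto
qed

definition remainder_ser :: "(nat \<Rightarrow> nat \<Rightarrow> bool) \<Rightarrow> int poly fps" where
  "remainder_ser r = Abs_fps (\<lambda>s. \<Sum>h\<le>s. remainder_poly r (h + 1) h (s - h) [:0, 1:])"

lemma remainder_ser_rec:
  assumes r: "r = (<) \<or> r = (>)"
  shows "remainder_ser r = lift_q remainder_count_ser + fps_const ([:0, 1:] - 1) * (fps_X * (F_ser * remainder_ser r))"
proof (rule fps_ext)
  fix s
  let ?q = "[:0, 1:] :: int poly"
  let ?f = "\<lambda>h k. of_nat (fact k) * remainder_poly r (h - 1 - k + 1) (h - 1 - k) (s - h) ?q"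
  have "remainder_ser r $ s = (\<Sum>h\<le>s. of_nat (card (remainders r (h + 1) h (s - h))) +
      (?q - 1) * (\<Sum>k<h. ?f h k))"
    unfolding remainder_ser_def fps_nth_Abs_fps
  proof (rule sum.cong[OF refl])
    fix h
    have "remainder_poly r (h + 1) (h - 1 - k) u ?q = remainder_poly r (h - 1 - k + 1) (h - 1 - k) u ?q" for k u
      by (rule remainder_poly_indep[OF r]) auto
    then have "(\<Sum>k<h. of_nat (fact k) * remainder_poly r (h + 1) (h - 1 - k) (s - h) ?q) = (\<Sum>k<h. ?f h k)"
      by (simp only:)
    then show "remainder_poly r (h + 1) h (s - h) ?q =
        of_nat (card (remainders r (h + 1) h (s - h))) + (?q - 1) * (\<Sum>k<h. ?f h k)"
      using remainder_poly_rec[of h "h + 1" r "s - h" ?q] by simp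
  qed
  also have "\<dots> = of_nat (remainder_count s) + (?q - 1) * (\<Sum>h\<le>s. \<Sum>k<h. ?f h k)"
    unfolding sum.distrib sum_distrib_left[symmetric] of_nat_sum[symmetric] sum_card_remainders[OF r] ..
  also have "(\<Sum>h\<le>s. \<Sum>k<h. ?f h k) = (\<Sum>k<s. \<Sum>j\<le>s - 1 - k. ?f (k + j + 1) k)"
    by (rule sum_triangle)
  also have "\<dots> = (fps_X * (F_ser * remainder_ser r)) $ s"
    unfolding fps_X_mult_mult_nth remainder_ser_def F_ser_def fps_nth_Abs_fps sum_distrib_left
    by (intro sum.cong refl) simp
  finally show "remainder_ser r $ s =
      (lift_q remainder_count_ser + fps_const (?q - 1) * (fps_X * (F_ser * remainder_ser r))) $ s"
    unfolding fps_add_nth fps_mult_left_const_nth by (simp add: lift_q_def remainder_count_ser_def of_nat_poly)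
qed

lemma F_biv_canonical_eq:
  assumes y: "y = 0 \<or> y = 2" and r: "r = (if y = 0 then (>) else (<))"
  shows "F_biv (canonical_mesh y) = F_ser + fps_const ([:0, 1:] - 1) * (fps_X * (fps_X * (F_ser * remainder_ser r)))"
proof (rule fps_ext)
  fix n
  let ?q = "[:0, 1:] :: int poly"
  have r': "r = (<) \<or> r = (>)" using r by auto
  have os: "one_sided r" using r' by (auto simp: one_sided_def)
  have "(\<Sum>k<n. \<Sum>a\<in>{1..<n - k}. of_nat (fact k) * remainder_poly r (a + k + 1) (a - 1) (n - (a + k + 1)) ?q) =
      (fps_X * (fps_X * (F_ser * remainder_ser r))) $ n"
  proof (cases n)
    case 0
    then show ?thesis by simp
  next
    case (Suc m)
    have "(\<Sum>k<n. \<Sum>a\<in>{1..<n - k}. of_nat (fact k) * remainder_poly r (a + k + 1) (a - 1) (n - (a + k + 1)) ?q) =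
        (\<Sum>k<m. \<Sum>a\<in>{1..<n - k}. of_nat (fact k) * remainder_poly r (a + k + 1) (a - 1) (n - (a + k + 1)) ?q)"
      by (simp add: Suc)
    also have "\<dots> = (\<Sum>k<m. F_ser $ k * remainder_ser r $ (m - 1 - k))"
    proof (rule sum.cong[OF refl])
      fix k assume k: "k \<in> {..<m}"
      have "(\<Sum>a\<in>{1..<n - k}. of_nat (fact k) * remainder_poly r (a + k + 1) (a - 1) (n - (a + k + 1)) ?q) =
          (\<Sum>h\<le>m - 1 - k. of_nat (fact k) * remainder_poly r (h + 1) h (m - 1 - k - h) ?q)"
      proof (rule sum.reindex_bij_witness[where i = "\<lambda>h. h + 1" and j = "\<lambda>a. a - 1"])
        fix a assume a: "a \<in> {1..<n - k}"
        have "n - (a + k + 1) = m - 1 - k - (a - 1)" using a Suc by auto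
        moreover have "remainder_poly r (a - 1 + 1) (a - 1) u ?q = remainder_poly r (a + k + 1) (a - 1) u ?q" for u
          by (rule remainder_poly_indep[OF r']) auto
        ultimately show "of_nat (fact k) * remainder_poly r (a - 1 + 1) (a - 1) (m - 1 - k - (a - 1)) ?q =
            of_nat (fact k) * remainder_poly r (a + k + 1) (a - 1) (n - (a + k + 1)) ?q"
          by (simp only:)
      qed (use k Suc in auto)
      then show "(\<Sum>a\<in>{1..<n - k}. of_nat (fact k) * remainder_poly r (a + k + 1) (a - 1) (n - (a + k + 1)) ?q) =
          F_ser $ k * remainder_ser r $ (m - 1 - k)"
        by (simp add: F_ser_def remainder_ser_def sum_distrib_left)
    qed
    also have "\<dots> = (fps_X * (F_ser * remainder_ser r)) $ m" by (simp only: fps_X_mult_mult_nth)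
    also have "\<dots> = (fps_X * (fps_X * (F_ser * remainder_ser r))) $ n" by (simp only: Suc fps_X_mult_nth) simp
    finally show ?thesis .
  qed
  then show "F_biv (canonical_mesh y) $ n =
      (F_ser + fps_const (?q - 1) * (fps_X * (fps_X * (F_ser * remainder_ser r)))) $ n"
    unfolding F_biv_canonical[OF y] r[symmetric] sum_power_occ_starts[OF os]
    by (simp only: fps_add_nth fps_mult_left_const_nth) (simp add: F_ser_def)
qed

text \<open>
  Eliminating \<open>Z\<close> gives \<open>F Z = T N\<close>, and \<open>(q - 1) T N = q T C - F C\<close> separates a multiple of
  \<open>q\<close> from a part that is free of \<open>q\<close>.
\<close>
lemma F_biv_canonical_eq_terminal:
  assumes y: "y = 0 \<or> y = 2"
  shows "F_biv (canonical_mesh y) =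
    fps_const [:0, 1:] * (fps_X ^ 2 * (T_ser * lift_q terminal_ser)) + lift_q (F_ser - fps_X * (fps_X * (F_ser * terminal_ser)))"
proof -
  define r :: "nat \<Rightarrow> nat \<Rightarrow> bool" where "r = (if y = 0 then (>) else (<))"
  have r': "r = (<) \<or> r = (>)" by (simp add: r_def)
  define Z N c q F T where defs: "Z = remainder_ser r" "N = lift_q remainder_count_ser" "c = lift_q terminal_ser"
    "q = fps_const ([:0, 1:] :: int poly)" "F = (F_ser :: int poly fps)" "T = T_ser"
  have q1: "fps_const ([:0, 1:] - 1 :: int poly) = q - 1" "fps_const (1 - [:0, 1:] :: int poly) = 1 - q"
    unfolding defs fps_const_sub[symmetric] by simp_all
  have Z: "Z = N + (q - 1) * (fps_X * (F * Z))"
    using remainder_ser_rec[OF r'] unfolding q1 defs[symmetric] .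
  have T: "T * (1 + fps_X * (1 - q) * F) = F"
    using T_ser_mult unfolding q1 defs[symmetric] .
  have c: "c * (1 + fps_X * F) = N"
    using arg_cong[OF terminal_ser_mult, of lift_q]
    by (simp only: lift_q_mult lift_q_add lift_q_1 lift_q_fps_X lift_q_F_ser defs)
  have W: "F_biv (canonical_mesh y) = F + (q - 1) * (fps_X * (fps_X * (F * Z)))"
    using F_biv_canonical_eq[OF y r_def] unfolding q1 defs[symmetric] .
  \<comment> \<open>Series over \<open>\<int>[q]\<close> form an integral domain, so this factor can be cancelled.\<close>
  have D: "1 + fps_X * (1 - q) * F \<noteq> 0"
  proof
    assume "1 + fps_X * (1 - q) * F = 0"
    then have "(1 + fps_X * ((1 - q) * F)) $ 0 = 0" by (simp add: mult.assoc)
    then show False by simp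
  qed
  have "(F * Z) * (1 + fps_X * (1 - q) * F) = F * (Z - (q - 1) * (fps_X * (F * Z)))" by (simp add: algebra_simps)
  also have "Z - (q - 1) * (fps_X * (F * Z)) = N" using Z by (metis add_diff_cancel_right')
  also have "F * N = (T * N) * (1 + fps_X * (1 - q) * F)" by (subst T[symmetric]) (simp add: algebra_simps)
  finally have FZ: "F * Z = T * N" using D by (simp only: mult_cancel_right) blast
  have "(q - 1) * (T * N) = T * c * ((q - 1) * (1 + fps_X * F))" unfolding c[symmetric] by (simp add: algebra_simps)
  also have "\<dots> = q * (T * c) - (T * (1 + fps_X * (1 - q) * F)) * c" by (simp add: algebra_simps)
  finally have TN: "(q - 1) * (T * N) = q * (T * c) - F * c" unfolding T .
  have "F_biv (canonical_mesh y) = F + fps_X * (fps_X * ((q - 1) * (T * N)))" unfolding W FZ by (simp add: algebra_simps)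
  also have "\<dots> = q * (fps_X ^ 2 * (T * c)) + (F - fps_X * (fps_X * (F * c)))" unfolding TN
    by (simp add: algebra_simps power2_eq_square)
  finally show ?thesis
    unfolding defs by (simp only: lift_q_mult lift_q_minus lift_q_fps_X lift_q_F_ser)
qed

lemma F_ge1_eqI:
  assumes "F_biv R = fps_const [:0, 1:] * G + lift_q H"
  shows "F_ge1 R = fps_const [:0, 1:] * G"
proof -
  have "A_ser R = H"
    unfolding A_ser_def assms by (rule fps_ext) (simp add: subst_q_def lift_q_def)
  then show ?thesis unfolding F_ge1_def assms by simp
qed

lemma A_ser_eq: "A_ser R = F_ser - subst_q (F_ge1 R) 1"
proof (rule fps_ext)
  fix n
  have "poly (F_biv R $ n) 1 = F_ser $ n"
    using arg_cong[OF subst_q_F_biv_1[of R], of "\<lambda>f. f $ n"] by (simp add: subst_q_def)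
  then show "A_ser R $ n = (F_ser - subst_q (F_ge1 R) 1) $ n"
    by (simp add: subst_q_def F_ge1_def lift_q_def)
qed

theorem theorem1p6:
  fixes R :: "(nat \<times> nat) set"
  assumes "R \<in> {
    {(0,2),(2,2),(1,1),(2,1),(0,0)},
    {(0,2),(2,2),(1,1),(0,0),(1,0)},
    {(1,2),(2,2),(1,1),(0,0),(2,0)},
    {(2,2),(0,1),(1,1),(0,0),(2,0)},
    {(0,2),(2,2),(0,1),(1,1),(2,0)},
    {(0,2),(1,2),(1,1),(0,0),(2,0)},
    {(0,2),(1,1),(2,1),(0,0),(2,0)},
    {(0,2),(2,2),(1,1),(1,0),(2,0)}}"
  shows "A_ser R = F_ser - subst_q (F_ge1 R) 1 \<and>
    F_ge1 R = Abs_fps (\<lambda>n. [:0, 1:] * (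
      (\<Sum>(i, j, k, m) \<in> {(i, j, k, m). i + j + k + m + 2 = n}.
         of_nat ((j + k) choose k) * of_nat (fact (i + j)) * T_coeff m * of_int (S_coeff k)) +
      (\<Sum>(i, j1, j2, k1, k2, m) \<in> {(i, j1, j2, k1, k2, m). i + j1 + j2 + k1 + k2 + m + 4 = n}.
         of_nat ((k2 + j2 + 1) choose k2) * of_nat ((k1 + j1) choose k1) * of_nat (fact k1) *
         of_nat (fact (i + j1 + j2 + 1)) * T_coeff m * of_int (S_coeff k2))))"
proof -
  obtain y where y: "y = 0 \<or> y = 2" and "F_biv R = F_biv (canonical_mesh y)"
    using F_biv_eight_patterns[OF assms] by blast
  then have "F_ge1 R = fps_const [:0, 1:] * (fps_X ^ 2 * (T_ser * lift_q terminal_ser))"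
    using F_biv_canonical_eq_terminal[OF y] by (intro F_ge1_eqI) simp
  then show ?thesis unfolding formula_eq_terminal_ser using A_ser_eq by blast
qed

end
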